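(* Let $\mathbb K$ be a local field of characteristic zero, let $n\ge1$, and let $G=\mathbb K^*\ltimes\mathbb K^n$ be the semidirect product of $\mathbb K^*$, the multiplicative group of non-zero elements of $\mathbb K$, and $\mathbb K^n$, where the action of $\mathbb K^*$ on $\mathbb K^n$ is given by $$a\cdot(a_1,\dots,a_n)=(aa_1,\dots,aa_n)$$ for all $a\in\mathbb K^*$ and $(a_1,\dots,a_n)\in\mathbb K^n$. Then no representation of $G$ has any rate of random mixing; that is, for every unitary system $(G,\mu,\pi,\mathcal H)$ on this group $G$ with $\mathcal H\neq\{0\}$, there is no rate of random mixing for $(G,\mu,\pi,\mathcal H)$.
   Context: A local field is a non-discrete locally compact topological field. The group $G=\mathbb K^*\ltimes\mathbb K^n$ carries the product topology, and is a locally compact group. For a locally compact group $G$, let $\mathcal P(G)$ be the set of regular Borel probability measures on $G$. For $\mu\in\mathcal P(G)$ and $k\ge1$, $\mu^k$ denotes the $k$-th convolution power of $\mu$. A measure $\mu\in\mathcal P(G)$ is called adapted if it is not supported on a proper closed subgroup of $G$; strictly aperiodic if it is not supported on a coset of a proper closed normal subgroup of $G$; spread-out if for some $k\ge1$ the measure $\mu^k$ is not singular with respect to a Haar measure on $G$. A unitary system $(G,\mu,\pi,\mathcal H)$ consists of a locally compact group $G$, an adapted, strictly aperiodic, spread-out measure $\mu\in\mathcal P(G)$, and a (strongly continuous) unitary representation $\pi$ of $G$ on a Hilbert space $\mathcal H$. Let $(G^{\mathbb N},\mu^{\mathbb N})$ be the product probability space $\prod_{i=1}^\infty (G,\mu)$.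 For $\omega=(\omega_m)_{m\ge1}\in G^{\mathbb N}$ and $m\ge1$ put $g_m^\omega=\omega_m\cdots\omega_2\omega_1$. A decreasing sequence $(a_m)$ of positive real numbers with $a_m\to0$ is said to form a rate of random mixing for $(G,\mu,\pi,\mathcal H)$ if for every $u,v\in\mathcal H$, for $\mu^{\mathbb N}$-almost every $\omega$, $$\limsup_{m\to\infty}\frac{|\langle\pi(g_m^\omega)u,v\rangle|}{a_m}<\infty .$$ *)

theory Defs
  imports "HOL-Probability.Probability" "HOL-Algebra.Coset"
begin

section \<open>Local fields\<close>

text \<open>As usual for locally compact fields and groups, the Hausdorff axiom is part of the definition.\<close>

class local_field = field + t2_space + topological_ab_group_add + topological_semigroup_mult +
  assumes continuous_inverse: "x \<noteq> 0 \<Longrightarrow> (inverse \<longlongrightarrow> inverse x) (at x)"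
    and not_discrete: "\<exists>S. \<not> open S"
    and locally_compact: "\<exists>U K. open U \<and> compact K \<and> x \<in> U \<and> U \<subseteq> K"


section \<open>Complex Hilbert spaces\<close>

text \<open>The complex structure sits on top of the library's real Hilbert spaces: the real inner
  product, which determines norm and topology, is the real part of the complex one.\<close>

class complex_hilbert_space = real_inner + complete_space +
  fixes scaleC :: "complex \<Rightarrow> 'a \<Rightarrow> 'a"
    and cinner :: "'a \<Rightarrow> 'a \<Rightarrow> complex"
  assumes scaleC_add_right: "scaleC c (x + y) = scaleC c x + scaleC c y"
    and scaleC_add_left: "scaleC (c + d) x = scaleC c x + scaleC d x"
    and scaleC_scaleC: "scaleC c (scaleC d x) = scaleC (c * d) x"
    and scaleC_of_real: "scaleC (complex_of_real r) x = scaleR r x"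
    and cinner_add_left: "cinner (x + y) z = cinner x z + cinner y z"
    and cinner_scaleC_left: "cinner (scaleC c x) y = c * cinner x y"
    and cinner_commute: "cinner x y = cnj (cinner y x)"
    and inner_eq_Re_cinner: "inner x y = Re (cinner x y)"


section \<open>Measures on locally compact groups\<close>

locale locally_compact_group = group G for G (structure) +
  fixes T :: "'g topology"
  assumes topspace_eq: "topspace T = carrier G"
    and hausdorff: "Hausdorff_space T"
    and locally_compact: "locally_compact_space T"
    and continuous_mult: "continuous_map (prod_topology T T) T (\<lambda>(x, y). x \<otimes> y)"
    and continuous_inv: "continuous_map T T (\<lambda>x. inv x)"

definition borel_of :: "'g topology \<Rightarrow> 'g measure" where
  "borel_of T = sigma (topspace T) {U. openin T U}"

definition regular_borel_measure :: "'g topology \<Rightarrow> 'g measure \<Rightarrow> bool" where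
  "regular_borel_measure T \<mu> \<longleftrightarrow>
     sets \<mu> = sets (borel_of T) \<and>
     (\<forall>K. compactin T K \<longrightarrow> emeasure \<mu> K < \<infinity>) \<and>
     (\<forall>A\<in>sets \<mu>. emeasure \<mu> A = (INF U\<in>{U. openin T U \<and> A \<subseteq> U}. emeasure \<mu> U)) \<and>
     (\<forall>U. openin T U \<longrightarrow> emeasure \<mu> U = (SUP K\<in>{K. compactin T K \<and> K \<subseteq> U}. emeasure \<mu> K))"

definition haar_measure :: "('g, 'b) monoid_scheme \<Rightarrow> 'g topology \<Rightarrow> 'g measure \<Rightarrow> bool" where
  "haar_measure G T m \<longleftrightarrow>
     regular_borel_measure T m \<and> emeasure m (space m) \<noteq> 0 \<and>
     (\<forall>x\<in>carrier G. \<forall>A\<in>sets m. emeasure m (x <#\<^bsub>G\<^esub> A) = emeasure m A)"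

definition mutually_singular :: "'g measure \<Rightarrow> 'g measure \<Rightarrow> bool" where
  "mutually_singular \<mu> \<nu> \<longleftrightarrow>
     (\<exists>N\<in>sets \<mu> \<inter> sets \<nu>. emeasure \<mu> N = 0 \<and> emeasure \<nu> (space \<nu> - N) = 0)"

text \<open>The convolution is \<open>A \<mapsto> \<integral> \<nu> (x\<inverse> A) d\<mu>(x)\<close>. It is not defined as an image of
  \<open>\<mu> \<Otimes>\<^sub>M \<nu>\<close>, because multiplication need not be measurable for the product
  \<open>\<sigma>\<close>-algebra if the group is not second countable.\<close>

definition mconv :: "('g, 'b) monoid_scheme \<Rightarrow> 'g topology \<Rightarrow> 'g measure \<Rightarrow> 'g measure \<Rightarrow> 'g measure" where
  "mconv G T \<mu> \<nu> = \<mu> \<bind> (\<lambda>x. distr \<nu> (borel_of T) (\<lambda>y. x \<otimes>\<^bsub>G\<^esub> y))"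

primrec conv_power :: "('g, 'b) monoid_scheme \<Rightarrow> 'g topology \<Rightarrow> 'g measure \<Rightarrow> nat \<Rightarrow> 'g measure" where
  "conv_power G T \<mu> 0 = return (borel_of T) \<one>\<^bsub>G\<^esub>"
| "conv_power G T \<mu> (Suc k) = mconv G T \<mu> (conv_power G T \<mu> k)"

text \<open>A closed set \<open>C\<close> contains the support of a regular Borel measure iff its complement is a null set.\<close>

definition adapted :: "('g, 'b) monoid_scheme \<Rightarrow> 'g topology \<Rightarrow> 'g measure \<Rightarrow> bool" where
  "adapted G T \<mu> \<longleftrightarrow>
     \<not> (\<exists>H. subgroup H G \<and> closedin T H \<and> H \<noteq> carrier G \<and> emeasure \<mu> (carrier G - H) = 0)"

definition strictly_aperiodic :: "('g, 'b) monoid_scheme \<Rightarrow> 'g topology \<Rightarrow> 'g measure \<Rightarrow> bool" where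
  "strictly_aperiodic G T \<mu> \<longleftrightarrow>
     \<not> (\<exists>N. N \<lhd> G \<and> closedin T N \<and> N \<noteq> carrier G \<and>
          (\<exists>x\<in>carrier G. emeasure \<mu> (carrier G - (N #>\<^bsub>G\<^esub> x)) = 0))"

definition spread_out :: "('g, 'b) monoid_scheme \<Rightarrow> 'g topology \<Rightarrow> 'g measure \<Rightarrow> bool" where
  "spread_out G T \<mu> \<longleftrightarrow>
     (\<exists>k\<ge>1. \<exists>m. haar_measure G T m \<and> \<not> mutually_singular (conv_power G T \<mu> k) m)"


section \<open>Unitary systems and rates of random mixing\<close>

definition unitary_operator :: "('h::complex_hilbert_space \<Rightarrow> 'h) \<Rightarrow> bool" where
  "unitary_operator f \<longleftrightarrow>
     (\<forall>u v. f (u + v) = f u + f v) \<and> (\<forall>c u. f (scaleC c u) = scaleC c (f u)) \<and>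
     (\<forall>u v. cinner (f u) (f v) = cinner u v) \<and> surj f"

definition unitary_representation ::
    "('g, 'b) monoid_scheme \<Rightarrow> 'g topology \<Rightarrow> ('g \<Rightarrow> 'h::complex_hilbert_space \<Rightarrow> 'h) \<Rightarrow> bool" where
  "unitary_representation G T \<pi> \<longleftrightarrow>
     (\<forall>g\<in>carrier G. unitary_operator (\<pi> g)) \<and>
     (\<forall>g\<in>carrier G. \<forall>h\<in>carrier G. \<pi> (g \<otimes>\<^bsub>G\<^esub> h) = \<pi> g \<circ> \<pi> h) \<and>
     (\<forall>u. continuous_map T euclidean (\<lambda>g. \<pi> g u))"

locale unitary_system = locally_compact_group G T for G (structure) and T :: "'g topology" +
  fixes \<mu> :: "'g measure"
    and \<pi> :: "'g \<Rightarrow> 'h::complex_hilbert_space \<Rightarrow> 'h"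
  assumes prob: "prob_space \<mu>"
    and regular: "regular_borel_measure T \<mu>"
    and adapted: "adapted G T \<mu>"
    and strictly_aperiodic: "strictly_aperiodic G T \<mu>"
    and spread_out: "spread_out G T \<mu>"
    and representation: "unitary_representation G T \<pi>"

text \<open>The coordinates of \<open>\<omega>\<close> are numbered from \<open>0\<close>, so \<open>random_walk G \<omega> m\<close> is the product
  \<open>\<omega> (m - 1) \<otimes> \<dots> \<otimes> \<omega> 0\<close> of the first \<open>m\<close> of them.\<close>

primrec random_walk :: "('g, 'b) monoid_scheme \<Rightarrow> (nat \<Rightarrow> 'g) \<Rightarrow> nat \<Rightarrow> 'g" where
  "random_walk G \<omega> 0 = \<one>\<^bsub>G\<^esub>"
| "random_walk G \<omega> (Suc m) = \<omega> m \<otimes>\<^bsub>G\<^esub> random_walk G \<omega> m"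

definition rate_of_random_mixing ::
    "('g, 'b) monoid_scheme \<Rightarrow> 'g measure \<Rightarrow> ('g \<Rightarrow> 'h::complex_hilbert_space \<Rightarrow> 'h) \<Rightarrow>
      (nat \<Rightarrow> real) \<Rightarrow> bool" where
  "rate_of_random_mixing G \<mu> \<pi> a \<longleftrightarrow>
     (\<forall>m\<ge>1. 0 < a m) \<and> (\<forall>m\<ge>1. a (Suc m) \<le> a m) \<and> a \<longlonglongrightarrow> 0 \<and>
     (\<forall>u v. AE \<omega> in (\<Pi>\<^sub>M i\<in>(UNIV :: nat set). \<mu>).
        limsup (\<lambda>m. ereal (cmod (cinner (\<pi> (random_walk G \<omega> m) u) v) / a m)) < \<infinity>)"


section \<open>The semidirect product of \<open>K\<^sup>*\<close> and \<open>K\<^sup>n\<close>\<close>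

definition scaling_group :: "('k::field \<times> ('k ^ 'n)) monoid" where
  "scaling_group = \<lparr>carrier = (- {0}) \<times> UNIV,
     mult = (\<lambda>(a, x) (b, y). (a * b, x + a *s y)), one = (1, 0)\<rparr>"

definition scaling_group_topology :: "('k::local_field \<times> ('k ^ 'n)) topology" where
  "scaling_group_topology = prod_topology (top_of_set (- {0})) euclidean"

end

theory Submission
  imports Defs
begin

text \<open>
  Suppose that \<open>a\<close> is a rate. For each pair \<open>u, v\<close> the quotients
  \<open>\<bar>\<langle>\<pi> g\<^sub>m u, v\<rangle>\<bar> / a m\<close> are almost surely bounded, with a bound and a null set that depend on the
  pair. Baire's theorem on \<open>H \<times> H\<close> makes this uniform
  (\<open>truncated_coefficients_uniformly_small\<close>): there are \<open>C, r > 0\<close> such that for all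
  \<open>m \<ge> 1\<close> and all \<open>u, v\<close> of norm less than \<open>r\<close> the expectation of
  \<open>min 1 (\<bar>\<langle>\<pi> g\<^sub>m u, v\<rangle>\<bar> / (C a m))\<close> is at most \<open>1/4\<close>. Now \<open>m\<close> can be fixed, so large that
  \<open>C a m \<le> r\<^sup>2/8\<close>, and vectors can be chosen that suit the law of the single element \<open>g\<^sub>m\<close>. A
  contradiction arises if some \<open>u, v\<close> of norm less than \<open>r\<close> have
  \<open>\<bar>\<langle>\<pi> g\<^sub>m u, v\<rangle>\<bar> \<ge> r\<^sup>2/8\<close> with probability at least \<open>1/2\<close>. They exist, up to a limit,
  because \<open>G\<close> is solvable, hence amenable; two elementary arguments take the place of amenability.

  The normal subgroup \<open>K\<^sup>n\<close> is contracted by the dilations. If \<open>t\<^sup>j \<rightarrow> 0\<close>, then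
  \<open>(a, x) (t\<^sup>-\<^sup>j, 0) = (t\<^sup>-\<^sup>j, 0) (a, t\<^sup>j x)\<close>, so the coefficients of \<open>\<pi> (a, x)\<close> at the
  translates of \<open>u, v\<close> by \<open>(t\<^sup>-\<^sup>j, 0)\<close> converge to \<open>\<langle>\<pi> (a, 0) u, v\<rangle>\<close>
  (\<open>dilation_limit_of_coefficient\<close>). The translates have the same norms, so by dominated
  convergence the bound \<open>1/4\<close> holds for the operators \<open>\<pi> (a, 0)\<close> too, where \<open>a\<close> is the
  \<open>K\<^sup>*\<close>-component of \<open>g\<^sub>m\<close>.

  These operators commute, and commuting unitary operators have approximate joint eigenvectors
  (\<open>approximate_joint_eigenvector\<close>). Since a separable orbit of \<open>K\<^sup>*\<close> is nearly exhausted by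
  finitely many small balls, up to small probability, some \<open>w \<noteq> 0\<close> is nearly an eigenvector of
  \<open>\<pi> (a, 0)\<close> with an eigenvalue of modulus one, on an event of probability at least \<open>1/2\<close>; there
  \<open>\<bar>\<langle>\<pi> (a, 0) w, w\<rangle>\<bar> \<ge> \<parallel>w\<parallel>\<^sup>2/2\<close> (\<open>random_almost_eigenvector\<close>). Scaled to norm \<open>r/2\<close>,
  this \<open>w\<close> gives the contradiction.

  The element \<open>t\<close>, found in \<open>topologically_nilpotent_unit\<close>, also shows that \<open>K\<close> is second
  countable. This makes the random walk measurable for the product \<open>\<sigma>\<close>-algebra and the orbits
  separable.
\<close>

section \<open>Local fields are second countable\<close>

lemma not_open_singleton_zero: "\<not> open {0 :: 'k::local_field}"
proof
  assume 0: "open {0 :: 'k}"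
  have "open {x}" for x :: 'k
  proof -
    have "open ((\<lambda>y. y - x) -` {0})"
      by (intro open_vimage 0 continuous_intros)
    also have "(\<lambda>y. y - x) -` {0} = {x}"
      by auto
    finally show ?thesis .
  qed
  then have "open S" for S :: "'k set"
    using open_UN[of S "\<lambda>x. {x}"] by simp
  then show False
    using not_discrete[where ?'a = 'k] by blast
qed

lemma isCont_inverse_local_field:
  fixes x :: "'k::local_field"
  shows "x \<noteq> 0 \<Longrightarrow> isCont inverse x"
  unfolding isCont_def by (rule continuous_inverse)

text \<open>Multiplication maps \<open>{0} \<times> K\<close> into \<open>U\<close>, so by the tube lemma it maps a whole neighbourhood
  \<open>W \<times> K\<close> into \<open>U\<close>.\<close>

lemma absorbing_neighbourhood:
  fixes K U :: "'k::local_field set"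
  assumes "compact K" "open U" "0 \<in> U"
  obtains W where "open W" "0 \<in> W" "\<And>w x. w \<in> W \<Longrightarrow> x \<in> K \<Longrightarrow> w * x \<in> U"
proof -
  have "open ((\<lambda>p. fst p * snd p) -` U)" (is "open ?S")
    by (intro open_vimage assms continuous_on_mult' continuous_intros)
  moreover have "{0} \<times> K \<subseteq> ?S"
    using assms by auto
  ultimately have "\<exists>W. 0 \<in> W \<and> open W \<and> W \<times> K \<subseteq> ?S"
    by (rule Elementary_Topology.tube_lemma[OF \<open>compact K\<close>])
  then obtain W where "0 \<in> W" "open W" "W \<times> K \<subseteq> ?S"
    by (elim exE conjE)
  then show ?thesis
    by (intro that[of W]) auto
qed

lemma compact_neighbourhood_avoiding_one:
  obtains K U :: "'k::local_field set"
  where "compact K" "open U" "0 \<in> U" "U \<subseteq> K" "1 \<notin> K"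
proof -
  obtain U K :: "'k set" where UK: "open U" "compact K" "0 \<in> U" "U \<subseteq> K"
    using local_field_class.locally_compact[of 0] by (elim exE conjE) (rule that)
  obtain A B :: "'k set" where AB: "open A" "open B" "0 \<in> A" "1 \<in> B" "A \<inter> B = {}"
    using hausdorff[of "0::'k" 1] by auto
  show ?thesis
    by (rule that[of "K - B" "U \<inter> A"]) (use UK AB in \<open>auto intro!: compact_diff\<close>)
qed

text \<open>By compactness it suffices that \<open>0\<close> is the only cluster point of the powers. If they cluster at
  \<open>s \<noteq> 0\<close>, then two powers \<open>t\<^sup>n\<close>, \<open>t\<^sup>m\<close> with \<open>n < m\<close> are both so close to \<open>s\<close> that their quotient
  \<open>t\<^sup>m\<^sup>-\<^sup>n\<close> is close to \<open>1\<close>; but it lies in the closed set \<open>K\<close>, which omits \<open>1\<close>.\<close>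

lemma powers_tendsto_zero:
  fixes K :: "'k::local_field set"
  assumes "compact K" "1 \<notin> K" "t \<noteq> 0" and powers: "\<And>n. n \<ge> 1 \<Longrightarrow> t ^ n \<in> K"
  shows "(\<lambda>n. t ^ n) \<longlonglongrightarrow> 0"
proof (rule topological_tendstoI)
  fix S :: "'k set" assume S: "open S" "0 \<in> S"
  show "\<forall>\<^sub>F n in sequentially. t ^ n \<in> S"
  proof (rule ccontr)
    assume not: "\<not> (\<forall>\<^sub>F n in sequentially. t ^ n \<in> S)"
    \<comment> \<open>The filter of the tails of those powers that lie outside \<open>S\<close>. Filters are used because first
      countability, hence sequential compactness, is not yet known.\<close>
    define F where "F = filtermap (\<lambda>n. t ^ n) (inf sequentially (principal {n. t ^ n \<notin> S}))"
    have "F \<noteq> bot"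
      using not unfolding F_def trivial_limit_def
      by (simp add: eventually_filtermap eventually_inf_principal)
    moreover have "eventually (\<lambda>x. x \<in> K) F"
      unfolding F_def eventually_filtermap eventually_inf_principal
      using eventually_ge_at_top[of 1] by eventually_elim (use powers in auto)
    ultimately obtain s where s: "s \<in> K" "inf (nhds s) F \<noteq> bot"
      using \<open>compact K\<close> unfolding compact_filter by blast
    have cluster: "\<exists>n\<ge>k. t ^ n \<in> M \<and> t ^ n \<notin> S" if M: "open M" "s \<in> M" for M k
    proof (rule ccontr)
      assume none: "\<not> ?thesis"
      have "eventually (\<lambda>x. x \<notin> M) F"
        unfolding F_def eventually_filtermap eventually_inf_principal
        using eventually_ge_at_top[of k] by eventually_elim (use none in auto)
      moreover have "eventually (\<lambda>x. x \<in> M) (nhds s)"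
        using M by (rule eventually_nhds_in_open)
      ultimately have "eventually (\<lambda>x. False) (inf (nhds s) F)"
        unfolding eventually_inf by fastforce
      then show False
        using s by (simp add: trivial_limit_def)
    qed
    have "s \<noteq> 0"
      using cluster[of S] S by auto
    then have "isCont inverse s"
      by (rule isCont_inverse_local_field)
    then have "((\<lambda>p. snd p * inverse (fst p)) \<longlongrightarrow> s * inverse s) (nhds (s, s))"
      unfolding isCont_def tendsto_at_iff_tendsto_nhds nhds_prod
      by (intro tendsto_intros filterlim_compose[OF _ filterlim_fst] filterlim_snd)
    then have "((\<lambda>p. snd p * inverse (fst p)) \<longlongrightarrow> 1) (nhds (s, s))"
      using \<open>s \<noteq> 0\<close> by simp
    moreover have "open (- K)"
      using \<open>compact K\<close> by (simp add: compact_imp_closed open_Compl)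
    ultimately have "eventually (\<lambda>p. snd p * inverse (fst p) \<in> - K) (nhds (s, s))"
      using \<open>1 \<notin> K\<close> by (intro topological_tendstoD) auto
    then obtain P where P: "eventually P (nhds s)"
      and PK: "\<And>x y. P x \<Longrightarrow> P y \<Longrightarrow> y * inverse x \<notin> K"
      unfolding nhds_prod eventually_prod_same by force
    obtain M where M: "open M" "s \<in> M" "\<And>x. x \<in> M \<Longrightarrow> P x"
      using P unfolding eventually_nhds by blast
    obtain n m where "t ^ n \<in> M" "n \<ge> 1" "t ^ m \<in> M" "m \<ge> Suc n"
      using cluster[OF M(1,2)] by meson
    moreover have "t ^ m * inverse (t ^ n) = t ^ (m - n)"
      using \<open>m \<ge> Suc n\<close> \<open>t \<noteq> 0\<close> by (simp add: power_diff field_simps)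
    ultimately show False
      using PK[of "t ^ n" "t ^ m"] M(3) powers[of "m - n"] by auto
  qed
qed

text \<open>Take a compact neighbourhood \<open>K\<close> of \<open>0\<close> that omits \<open>1\<close>. A small enough \<open>t \<noteq> 0\<close> multiplies
  \<open>K\<close> into itself, so that its powers stay in \<open>K\<close>; it exists since the topology is not discrete.\<close>

lemma topologically_nilpotent_unit:
  obtains t :: "'k::local_field" where "t \<noteq> 0" "(\<lambda>n. t ^ n) \<longlonglongrightarrow> 0"
proof -
  obtain K U :: "'k set" where KU: "compact K" "open U" "0 \<in> U" "U \<subseteq> K" "1 \<notin> K"
    by (rule compact_neighbourhood_avoiding_one)
  obtain W where W: "open W" "0 \<in> W" "\<And>w x. w \<in> W \<Longrightarrow> x \<in> K \<Longrightarrow> w * x \<in> U"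
    using absorbing_neighbourhood[OF KU(1-3)] by blast
  have "open (W \<inter> U)" "0 \<in> W \<inter> U"
    using W KU by auto
  then have "W \<inter> U \<noteq> {0}"
    using not_open_singleton_zero[where ?'k = 'k] by metis
  then obtain t where t: "t \<in> W" "t \<in> U" "t \<noteq> 0"
    using \<open>0 \<in> W \<inter> U\<close> by blast
  have "t ^ Suc n \<in> U" for n
    by (induction n) (use t W KU in auto)
  then have "t ^ n \<in> K" if "n \<ge> 1" for n
    using that KU(4) by (cases n) auto
  then show ?thesis
    using powers_tendsto_zero[OF KU(1,5)] t that by blast
qed

text \<open>Let \<open>U\<close> be a neighbourhood of \<open>0\<close> inside a compact set \<open>K\<close>, and \<open>t\<^sup>n \<rightarrow> 0\<close> with \<open>t \<noteq> 0\<close>. The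
  sets \<open>t\<^sup>n U\<close> are arbitrarily small and the compact sets \<open>t\<^sup>-\<^sup>m K\<close> exhaust the field. Finitely many
  translates of \<open>t\<^sup>n U\<close> cover each \<open>t\<^sup>-\<^sup>m K\<close>, and all these translates together form a basis.\<close>

lemma countable_basis_local_field:
  "\<exists>B :: 'a::local_field set set. countable B \<and> topological_basis B"
proof -
  obtain U K :: "'a set" where UK: "open U" "compact K" "0 \<in> U" "U \<subseteq> K"
    using local_field_class.locally_compact[of 0] by (elim exE conjE) (rule that)
  obtain t :: 'a where t: "t \<noteq> 0" "(\<lambda>n. t ^ n) \<longlonglongrightarrow> 0"
    by (rule topologically_nilpotent_unit)
  define V where "V d n = {x. x - d \<in> (*) (t ^ n) ` U}" for d n
  have V_iff: "x \<in> V d n \<longleftrightarrow> (x - d) * inverse (t ^ n) \<in> U" for x d n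
  proof -
    have "x - d = t ^ n * u \<longleftrightarrow> (x - d) * inverse (t ^ n) = u" for u
      using t(1) by (auto simp: field_simps)
    then show ?thesis
      unfolding V_def image_iff mem_Collect_eq by simp
  qed
  have V_refl: "x \<in> V x n" for x n
    by (simp add: V_iff UK)
  have open_V: "open (V d n)" for d n
  proof -
    have "V d n = (\<lambda>x. (x - d) * inverse (t ^ n)) -` U"
      using V_iff by auto
    then show ?thesis
      by (simp only:) (intro open_vimage UK continuous_on_mult' continuous_intros)
  qed
  have "\<exists>D. finite D \<and> (*) (inverse (t ^ m)) ` K \<subseteq> (\<Union>d\<in>D. V d n)" for m n
  proof -
    have cpt: "compact ((*) (inverse (t ^ m)) ` K)"
      by (intro compact_continuous_image UK continuous_on_mult' continuous_intros)
    have sub: "(*) (inverse (t ^ m)) ` K \<subseteq> (\<Union>d\<in>UNIV. V d n)"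
      using V_refl by (intro subsetI UN_I UNIV_I)
    obtain D where "D \<subseteq> UNIV" "finite D" "(*) (inverse (t ^ m)) ` K \<subseteq> (\<Union>d\<in>D. V d n)"
      by (rule compactE_image[OF cpt, of UNIV "\<lambda>d. V d n", OF open_V sub])
    then show ?thesis
      by blast
  qed
  then obtain D where D: "\<And>m n. finite (D m n)"
    "\<And>m n. (*) (inverse (t ^ m)) ` K \<subseteq> (\<Union>d\<in>D m n. V d n)"
    by metis
  define B where "B = (\<lambda>(d, n). V d n) ` ((\<Union>m n. D m n) \<times> UNIV)"
  have "countable B"
    unfolding B_def using D(1) by (intro countable_image countable_SIGMA countable_UN) (auto intro: countable_finite)
  moreover have "topological_basis B"
  proof (rule topological_basisI)
    show "open S" if "S \<in> B" for S
      using that open_V unfolding B_def by auto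
  next
    fix S :: "'a set" and x assume S: "open S" "x \<in> S"
    \<comment> \<open>Two points of one translate of \<open>t\<^sup>n U\<close> differ by an element of \<open>t\<^sup>n K'\<close>.\<close>
    define K' where "K' = (\<lambda>p. fst p - snd p) ` (K \<times> K)"
    have "compact K'"
      unfolding K'_def by (intro compact_continuous_image compact_Times UK continuous_intros)
    moreover have "open ((+) x -` S)" "0 \<in> (+) x -` S"
      using S by (auto intro!: open_vimage continuous_intros)
    ultimately obtain W where W: "open W" "0 \<in> W" "\<And>w z. w \<in> W \<Longrightarrow> z \<in> K' \<Longrightarrow> w * z \<in> (+) x -` S"
      using absorbing_neighbourhood by blast
    obtain n where n: "t ^ n \<in> W"
      using eventually_happens'[OF sequentially_bot topological_tendstoD[OF t(2) W(1,2)]] by (elim exE)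
    have "(\<lambda>m. x * t ^ m) \<longlonglongrightarrow> x * 0"
      by (intro tendsto_mult tendsto_const t)
    then have "eventually (\<lambda>m. x * t ^ m \<in> U) sequentially"
      by (rule topological_tendstoD) (simp_all add: UK)
    then obtain m where m: "x * t ^ m \<in> U"
      using eventually_happens'[OF sequentially_bot] by blast
    have "x = inverse (t ^ m) * (x * t ^ m)"
      using t(1) by (simp add: field_simps)
    then have "x \<in> (*) (inverse (t ^ m)) ` K"
      using m UK by blast
    then obtain d where d: "d \<in> D m n" "x \<in> V d n"
      using D(2) by blast
    moreover have "V d n \<subseteq> S"
    proof
      fix y assume "y \<in> V d n"
      then obtain u v where uv: "u \<in> U" "v \<in> U" "x - d = t ^ n * u" "y - d = t ^ n * v"
        using d unfolding V_def by auto
      have "v - u \<in> K'"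
        unfolding K'_def using uv UK by (intro image_eqI[of _ _ "(v, u)"]) auto
      then have "t ^ n * (v - u) \<in> (+) x -` S"
        by (rule W(3)[OF n])
      moreover have "x + t ^ n * (v - u) = y"
        using uv by (simp add: algebra_simps)
      ultimately show "y \<in> S"
        by (simp only: vimage_eq)
    qed
    ultimately show "\<exists>b\<in>B. x \<in> b \<and> b \<subseteq> S"
      unfolding B_def by (intro bexI[of _ "V d n"] conjI rev_image_eqI[of "(d, n)"]) auto
  qed
  ultimately show ?thesis
    by blast
qed

instance local_field \<subseteq> second_countable_topology
proof
  show "\<exists>B::'a set set. countable B \<and> open = generate_topology B"
  proof -
    obtain B :: "'a set set" where "countable B" "topological_basis B"
      using countable_basis_local_field by (elim exE conjE)
    then show ?thesis
      by (intro exI[of _ B] conjI topological_basis_imp_subbasis)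
  qed
qed

section \<open>Complex Hilbert spaces and unitary operators\<close>

lemma cinner_add_right: "cinner x (y + z) = cinner x y + cinner (x :: 'h::complex_hilbert_space) z"
  by (metis cinner_add_left cinner_commute complex_cnj_add)

lemma cinner_diff_left: "cinner (x - y) z = cinner x z - cinner (y :: 'h::complex_hilbert_space) z"
  using cinner_add_left[of "x - y" y z] by simp

lemma cinner_scaleC_right: "cinner x (scaleC c y) = cnj c * cinner (x :: 'h::complex_hilbert_space) y"
  by (metis cinner_scaleC_left cinner_commute complex_cnj_mult)

lemma cinner_self: "cinner x x = complex_of_real ((norm (x :: 'h::complex_hilbert_space))\<^sup>2)"
proof (rule complex_eqI)
  show "Re (cinner x x) = Re (complex_of_real ((norm x)\<^sup>2))"
    by (simp add: power2_norm_eq_inner inner_eq_Re_cinner)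
  show "Im (cinner x x) = Im (complex_of_real ((norm x)\<^sup>2))"
    using arg_cong[OF cinner_commute[of x x], of Im] by simp
qed

lemma norm_scaleC: "norm (scaleC c x) = cmod c * norm (x :: 'h::complex_hilbert_space)"
proof -
  have "cnj c * c = (complex_of_real (cmod c))\<^sup>2"
    using complex_norm_square[of c] by (simp add: mult.commute)
  then have "complex_of_real ((norm (scaleC c x))\<^sup>2) = complex_of_real ((cmod c * norm x)\<^sup>2)"
    unfolding cinner_self[symmetric] cinner_scaleC_left cinner_scaleC_right
    by (simp add: cinner_self power_mult_distrib flip: mult.assoc)
  then show ?thesis
    by (simp add: power2_eq_iff_nonneg flip: of_real_power)
qed

lemma cmod_cinner_le: "cmod (cinner x y) \<le> norm x * norm (y :: 'h::complex_hilbert_space)"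
proof (cases "cinner x y = 0")
  case False
  define c where "c = cnj (cinner x y) / cmod (cinner x y)"
  have "c * cinner x y = complex_of_real (cmod (cinner x y))"
    using False complex_norm_square[of "cinner x y"] by (simp add: c_def field_simps power2_eq_square)
  then have "cmod (cinner x y) = Re (c * cinner x y)"
    by simp
  also have "\<dots> = inner (scaleC c x) y"
    by (simp add: inner_eq_Re_cinner cinner_scaleC_left)
  also have "\<dots> \<le> norm (scaleC c x) * norm y"
    by (rule norm_cauchy_schwarz)
  also have "norm (scaleC c x) = norm x"
    using False by (simp add: norm_scaleC c_def norm_divide)
  finally show ?thesis .
qed simp

lemma scaleC_diff_right: "scaleC c (x - y) = scaleC c x - scaleC c (y :: 'h::complex_hilbert_space)"
  using scaleC_add_right[of c "x - y" y] by simp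

lemma scaleC_minus_left: "scaleC (- c) x = - scaleC c (x :: 'h::complex_hilbert_space)"
  using scaleC_add_left[of "- c" c x] scaleC_of_real[of 0 x] by (simp add: eq_neg_iff_add_eq_0)

lemma scaleC_one: "scaleC 1 x = (x :: 'h::complex_hilbert_space)"
  using scaleC_of_real[of 1 x] by simp

lemma parallelogram_law:
  "(norm (x + y))\<^sup>2 + (norm (x - y))\<^sup>2 = 2 * (norm x)\<^sup>2 + 2 * (norm (y :: 'h::real_inner))\<^sup>2"
  by (simp add: power2_norm_eq_inner inner_add_left inner_add_right inner_diff_left inner_diff_right)

context
  fixes f :: "'h::complex_hilbert_space \<Rightarrow> 'h"
  assumes f: "unitary_operator f"
begin

lemma unitary_add: "f (u + v) = f u + f v"
  and unitary_scaleC: "f (scaleC c u) = scaleC c (f u)"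
  and unitary_cinner: "cinner (f u) (f v) = cinner u v"
  using f unfolding unitary_operator_def by auto

lemma unitary_diff: "f (u - v) = f u - f v"
  using unitary_add[of "u - v" v] by simp

lemma unitary_norm: "norm (f u) = norm u"
  using unitary_cinner[of u u] by (simp add: cinner_self power2_eq_iff_nonneg flip: of_real_power)

end

lemma bounded_linear_scaleC: "bounded_linear (scaleC c :: 'h::complex_hilbert_space \<Rightarrow> 'h)"
proof (rule bounded_linear_intro)
  show "scaleC c (r *\<^sub>R x) = r *\<^sub>R scaleC c x" for r and x :: 'h
    by (simp add: scaleC_of_real[symmetric] scaleC_scaleC mult.commute)
  show "norm (scaleC c x) \<le> norm x * cmod c" for x :: 'h
    by (simp add: norm_scaleC)
qed (rule scaleC_add_right)

lemma tendsto_cinner: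
  fixes a b :: "'h::complex_hilbert_space"
  assumes "(f \<longlongrightarrow> a) F" "(g \<longlongrightarrow> b) F"
  shows "((\<lambda>x. cinner (f x) (g x)) \<longlongrightarrow> cinner a b) F"
proof -
  have "cinner x y = Complex (inner x y) (- inner (scaleC \<i> x) y)" for x y :: 'h
    by (simp add: complex_eq_iff inner_eq_Re_cinner cinner_scaleC_left)
  then show ?thesis
    by (simp only:) (intro tendsto_Complex tendsto_minus tendsto_inner assms
      bounded_linear.tendsto[OF bounded_linear_scaleC])
qed

lemma unitary_tendsto:
  fixes f :: "'h::complex_hilbert_space \<Rightarrow> 'h"
  assumes f: "unitary_operator f" and "(g \<longlongrightarrow> a) F"
  shows "((\<lambda>x. f (g x)) \<longlongrightarrow> f a) F"
proof (rule bounded_linear.tendsto[OF _ assms(2)])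
  show "bounded_linear f"
  proof (rule bounded_linear_intro)
    show "f (r *\<^sub>R x) = r *\<^sub>R f x" for r x
      using unitary_scaleC[OF f, of "complex_of_real r" x] by (simp add: scaleC_of_real)
    show "norm (f x) \<le> norm x * 1" for x
      by (simp add: unitary_norm[OF f])
  qed (rule unitary_add[OF f])
qed

section \<open>Approximate joint eigenvectors of commuting unitary operators\<close>

text \<open>Closure under squaring is what the halving step in \<open>eigenvector_defect_halving\<close> uses; the
  operators of a representation of an abelian group form such a family.\<close>

definition commuting_unitaries :: "('h::complex_hilbert_space \<Rightarrow> 'h) set \<Rightarrow> bool" where
  "commuting_unitaries R \<longleftrightarrow>
     (\<forall>f\<in>R. unitary_operator f \<and> f \<circ> f \<in> R) \<and> (\<forall>f\<in>R. \<forall>g\<in>R. f \<circ> g = g \<circ> f)"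

text \<open>The functionals \<open>q w = \<parallel>T w\<parallel>\<^sup>2\<close>, for linear \<open>T\<close> that commute with all members of \<open>R\<close>, satisfy
  this identity by the parallelogram law, and so do their sums and integrals. Its use: if \<open>w\<close> is
  replaced by one of the two vectors \<open>f w \<plusminus> \<theta> w\<close>, the quotient \<open>q w / \<parallel>w\<parallel>\<^sup>2\<close> does not
  increase for at least one choice of the sign.\<close>

definition invariant_quadratic ::
    "('h::complex_hilbert_space \<Rightarrow> 'h) set \<Rightarrow> ('h \<Rightarrow> real) \<Rightarrow> bool" where
  "invariant_quadratic R q \<longleftrightarrow>
     (\<forall>w. 0 \<le> q w) \<and>
     (\<forall>f\<in>R. \<forall>w \<theta>. cmod \<theta> = 1 \<longrightarrow> q (f w + scaleC \<theta> w) + q (f w - scaleC \<theta> w) = 4 * q w)"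

lemma invariant_quadratic_nonneg: "invariant_quadratic R q \<Longrightarrow> 0 \<le> q w"
  by (simp add: invariant_quadratic_def)

lemma invariant_quadratic_parallelogram:
  assumes "invariant_quadratic R q" "f \<in> R" "cmod \<theta> = 1"
  shows "q (f w + scaleC \<theta> w) + q (f w - scaleC \<theta> w) = 4 * q w"
  using assms(1)[unfolded invariant_quadratic_def, THEN conjunct2, rule_format, OF assms(2,3)] .

lemma invariant_quadratic_add:
  "invariant_quadratic R p \<Longrightarrow> invariant_quadratic R q \<Longrightarrow> invariant_quadratic R (\<lambda>w. p w + q w)"
  unfolding invariant_quadratic_def by (auto simp: algebra_simps) 

lemma norm_parallelogram_commuting:
  fixes T :: "'h::complex_hilbert_space \<Rightarrow> 'h"
  assumes f: "unitary_operator f" and "cmod \<theta> = 1"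
    and T: "\<And>x y. T (x + y) = T x + T y" "\<And>c x. T (scaleC c x) = scaleC c (T x)"
      "\<And>x. T (f x) = f (T x)"
  shows "(norm (T (f w + scaleC \<theta> w)))\<^sup>2 + (norm (T (f w - scaleC \<theta> w)))\<^sup>2 = 4 * (norm (T w))\<^sup>2"
proof -
  have "T (x - y) = T x - T y" for x y
    using T(1)[of "x - y" y] by simp
  then show ?thesis
    using parallelogram_law[of "f (T w)" "scaleC \<theta> (T w)"] assms
    by (simp add: unitary_norm[OF f] norm_scaleC)
qed

lemma invariant_quadratic_eigenvector_defect:
  assumes R: "commuting_unitaries R" and g: "g \<in> R"
  shows "invariant_quadratic R (\<lambda>w. (norm (g w - scaleC \<theta> w))\<^sup>2)"
  unfolding invariant_quadratic_def
proof (intro conjI ballI allI impI)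
  fix f w and \<kappa> :: complex
  assume f: "f \<in> R" and "cmod \<kappa> = 1"
  have uf: "unitary_operator f" and ug: "unitary_operator g"
    using R f g by (auto simp: commuting_unitaries_def)
  have "g (f x) = f (g x)" for x
    using R f g unfolding commuting_unitaries_def by (metis comp_apply)
  then show "(norm (g (f w + scaleC \<kappa> w) - scaleC \<theta> (f w + scaleC \<kappa> w)))\<^sup>2 +
      (norm (g (f w - scaleC \<kappa> w) - scaleC \<theta> (f w - scaleC \<kappa> w)))\<^sup>2 =
      4 * (norm (g w - scaleC \<theta> w))\<^sup>2"
    by (intro norm_parallelogram_commuting uf \<open>cmod \<kappa> = 1\<close>)
      (simp_all add: unitary_add[OF ug] unitary_scaleC[OF ug] unitary_diff[OF uf] unitary_scaleC[OF uf]
        scaleC_add_right scaleC_diff_right scaleC_scaleC mult.commute)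
qed simp

text \<open>Start with an approximate eigenvector \<open>v\<close> of \<open>f\<^sup>2\<close> with eigenvalue \<open>\<kappa>\<^sup>2\<close>. As
  \<open>f\<^sup>2 - \<kappa>\<^sup>2 = (f \<mp> \<kappa>) (f \<plusminus> \<kappa>)\<close>, the vectors \<open>f v \<plusminus> \<kappa> v\<close> have the same defect for \<open>f\<close>, with
  eigenvalues \<open>\<plusminus>\<kappa>\<close>, as \<open>v\<close> has for \<open>f\<^sup>2\<close>; but on average over the sign their squared norm is twice
  that of \<open>v\<close>, and so is \<open>q\<close>. Hence for one of the signs the relative squared defect is halved while the
  relative size of \<open>q\<close> is kept. Applied \<open>k\<close> times, from \<open>f\<close> to the power \<open>2\<^sup>k\<close> down to \<open>f\<close>, this gains the
  factor \<open>2\<^sup>k\<close>. The initial squared defect is at most \<open>4 \<parallel>w\<parallel>\<^sup>2\<close> since \<open>f\<close> is unitary.\<close>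

lemma eigenvector_defect_halving:
  fixes w :: "'h::complex_hilbert_space"
  assumes R: "commuting_unitaries R" and q: "invariant_quadratic R q"
    and f: "f \<in> R" and "w \<noteq> 0" "\<epsilon> \<ge> 0"
    and start: "q w + 4 * \<epsilon> * (norm w)\<^sup>2 \<le> C * (norm w)\<^sup>2"
  shows "\<exists>v \<theta>. v \<noteq> 0 \<and> cmod \<theta> = 1 \<and>
    q v + 2 ^ k * \<epsilon> * (norm (f v - scaleC \<theta> v))\<^sup>2 \<le> C * (norm v)\<^sup>2"
  using f
proof (induction k arbitrary: f)
  case 0
  then have uf: "unitary_operator f"
    using R by (auto simp: commuting_unitaries_def)
  have "norm (f w - scaleC 1 w) \<le> 2 * norm w"
    using norm_triangle_ineq4[of "f w" w] by (simp add: scaleC_one unitary_norm[OF uf])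
  then have "(norm (f w - scaleC 1 w))\<^sup>2 \<le> (2 * norm w)\<^sup>2"
    by (intro power_mono) auto
  then have "\<epsilon> * (norm (f w - scaleC 1 w))\<^sup>2 \<le> \<epsilon> * (2 * norm w)\<^sup>2"
    using \<open>\<epsilon> \<ge> 0\<close> by (rule mult_left_mono)
  then have "q w + \<epsilon> * (norm (f w - scaleC 1 w))\<^sup>2 \<le> C * (norm w)\<^sup>2"
    using start by (simp add: power_mult_distrib)
  then show ?case
    using \<open>w \<noteq> 0\<close> by (intro exI[of _ w] exI[of _ 1]) simp
next
  case (Suc k)
  have uf: "unitary_operator f" and "f \<circ> f \<in> R"
    using R Suc.prems by (auto simp: commuting_unitaries_def)
  from Suc.IH[OF \<open>f \<circ> f \<in> R\<close>] obtain v \<theta> where v: "v \<noteq> 0" "cmod \<theta> = 1"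
    and IH: "q v + 2 ^ k * \<epsilon> * (norm (f (f v) - scaleC \<theta> v))\<^sup>2 \<le> C * (norm v)\<^sup>2"
    by auto
  define \<kappa> where "\<kappa> = csqrt \<theta>"
  have \<kappa>: "\<kappa> * \<kappa> = \<theta>" "cmod \<kappa> = 1"
    unfolding \<kappa>_def using v(2) by (simp_all flip: power2_eq_square)
  define x y where "x = f v + scaleC \<kappa> v" and "y = f v - scaleC \<kappa> v"
  define defect where "defect = 2 ^ Suc k * \<epsilon> * (norm (f (f v) - scaleC \<theta> v))\<^sup>2"
  have x: "f x - scaleC \<kappa> x = f (f v) - scaleC \<theta> v"
    by (simp add: x_def unitary_add[OF uf] unitary_scaleC[OF uf] scaleC_add_right scaleC_scaleC \<kappa>)
  have y: "f y - scaleC (- \<kappa>) y = f (f v) - scaleC \<theta> v"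
    by (simp add: y_def unitary_diff[OF uf] unitary_scaleC[OF uf] scaleC_diff_right scaleC_scaleC
        scaleC_minus_left \<kappa>)
  have norms: "(norm x)\<^sup>2 + (norm y)\<^sup>2 = 4 * (norm v)\<^sup>2"
    unfolding x_def y_def using parallelogram_law[of "f v" "scaleC \<kappa> v"] \<kappa>
    by (simp add: unitary_norm[OF uf] norm_scaleC)
  have qs: "q x + q y = 4 * q v" "q x \<ge> 0" "q y \<ge> 0"
    unfolding x_def y_def
    by (rule invariant_quadratic_parallelogram[OF q Suc.prems \<kappa>(2)] invariant_quadratic_nonneg[OF q])+
  have "defect \<ge> 0"
    unfolding defect_def using \<open>\<epsilon> \<ge> 0\<close> by simp
  have "(q x + defect) + (q y + defect) = 4 * (q v + 2 ^ k * \<epsilon> * (norm (f (f v) - scaleC \<theta> v))\<^sup>2)"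
    using qs by (simp add: defect_def)
  also have "\<dots> \<le> 4 * (C * (norm v)\<^sup>2)"
    using IH by simp
  also have "\<dots> = C * (norm x)\<^sup>2 + C * (norm y)\<^sup>2"
    unfolding distrib_left[symmetric] norms by simp
  finally have sum: "(q x + defect) + (q y + defect) \<le> C * (norm x)\<^sup>2 + C * (norm y)\<^sup>2" .
  have "(x \<noteq> 0 \<and> q x + defect \<le> C * (norm x)\<^sup>2) \<or> (y \<noteq> 0 \<and> q y + defect \<le> C * (norm y)\<^sup>2)"
  proof (cases "x = 0 \<or> y = 0")
    case True
    then show ?thesis
      using sum norms v(1) qs \<open>defect \<ge> 0\<close> by auto
  next
    case False
    then show ?thesis
      using sum by auto
  qed
  then show ?case
  proof
    assume "x \<noteq> 0 \<and> q x + defect \<le> C * (norm x)\<^sup>2"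
    then show ?thesis
      using x \<kappa> by (intro exI[of _ x] exI[of _ \<kappa>]) (simp add: defect_def)
  next
    assume "y \<noteq> 0 \<and> q y + defect \<le> C * (norm y)\<^sup>2"
    then show ?thesis
      using y \<kappa> by (intro exI[of _ y] exI[of _ "- \<kappa>"]) (simp add: defect_def)
  qed
qed

text \<open>The strict inequality leaves room for an eigenvector defect with a small weight \<open>\<epsilon>\<close>, and halving
  it often enough brings the weight above \<open>1\<close>.\<close>

lemma approximate_eigenvector:
  fixes w :: "'h::complex_hilbert_space"
  assumes R: "commuting_unitaries R" and q: "invariant_quadratic R q"
    and f: "f \<in> R" and less: "q w < c * (norm w)\<^sup>2"
  shows "\<exists>v \<theta>. cmod \<theta> = 1 \<and> q v + (norm (f v - scaleC \<theta> v))\<^sup>2 < c * (norm v)\<^sup>2"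
proof -
  have "0 \<le> q w"
    using q by (rule invariant_quadratic_nonneg)
  then have "w \<noteq> 0"
    using less by auto
  then have pos: "(norm w)\<^sup>2 > 0"
    by simp
  define r where "r = q w / (norm w)\<^sup>2"
  have r: "q w = r * (norm w)\<^sup>2" "r < c"
    using less pos unfolding r_def by (simp_all add: field_simps)
  define \<epsilon> where "\<epsilon> = (c - r) / 8"
  have "\<epsilon> > 0"
    using r by (simp add: \<epsilon>_def)
  obtain k :: nat where k: "1 / \<epsilon> < 2 ^ k"
    using real_arch_pow[of 2 "1 / \<epsilon>"] by auto
  have "q w + 4 * \<epsilon> * (norm w)\<^sup>2 = (c + r) / 2 * (norm w)\<^sup>2"
    unfolding r(1) \<epsilon>_def by (simp add: field_simps)
  then obtain v \<theta> where v: "v \<noteq> 0" "cmod \<theta> = 1"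
    "q v + 2 ^ k * \<epsilon> * (norm (f v - scaleC \<theta> v))\<^sup>2 \<le> (c + r) / 2 * (norm v)\<^sup>2"
    using eigenvector_defect_halving[OF R q f \<open>w \<noteq> 0\<close>, of \<epsilon> "(c + r) / 2" k] \<open>\<epsilon> > 0\<close> by auto
  have "1 \<le> 2 ^ k * \<epsilon>"
    using k \<open>\<epsilon> > 0\<close> by (simp add: field_simps)
  then have "1 * (norm (f v - scaleC \<theta> v))\<^sup>2 \<le> 2 ^ k * \<epsilon> * (norm (f v - scaleC \<theta> v))\<^sup>2"
    by (rule mult_right_mono) simp
  moreover have "(c + r) / 2 * (norm v)\<^sup>2 < c * (norm v)\<^sup>2"
    using r v(1) by (intro mult_strict_right_mono) auto
  ultimately have "q v + (norm (f v - scaleC \<theta> v))\<^sup>2 < c * (norm v)\<^sup>2"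
    using v(3) by linarith
  then show ?thesis
    using v(2) by blast
qed

text \<open>The functional \<open>q\<close> carries the defects already obtained, so that the eigenvector for the next operator
  does not spoil the earlier ones.\<close>

lemma approximate_joint_eigenvector:
  fixes w :: "'h::complex_hilbert_space" and d :: "nat \<Rightarrow> 'h \<Rightarrow> 'h"
  assumes R: "commuting_unitaries R" and q: "invariant_quadratic R q"
    and d: "\<And>i. d i \<in> R" and less: "q w < c * (norm w)\<^sup>2"
  shows "\<exists>v \<theta>. (\<forall>i. cmod (\<theta> i) = 1) \<and>
    q v + (\<Sum>i<k. (norm (d i v - scaleC (\<theta> i) v))\<^sup>2) < c * (norm v)\<^sup>2"
proof (induction k)
  case 0
  show ?case
    using less by (intro exI[of _ w] exI[of _ "\<lambda>_. 1"]) simp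
next
  case (Suc k)
  then obtain v \<theta> where \<theta>: "\<And>i. cmod (\<theta> i) = 1"
    and v: "q v + (\<Sum>i<k. (norm (d i v - scaleC (\<theta> i) v))\<^sup>2) < c * (norm v)\<^sup>2"
    by blast
  have "invariant_quadratic R (\<lambda>v. q v + (\<Sum>i<j. (norm (d i v - scaleC (\<theta> i) v))\<^sup>2))" for j
  proof (induction j)
    case 0
    then show ?case
      using q by simp
  next
    case (Suc j)
    show ?case
      using invariant_quadratic_add[OF Suc invariant_quadratic_eigenvector_defect[OF R d]]
      by (simp add: add.assoc)
  qed
  from approximate_eigenvector[OF R this d v]
  obtain v' \<kappa> where "cmod \<kappa> = 1" and v': "q v' + (\<Sum>i<k. (norm (d i v' - scaleC (\<theta> i) v'))\<^sup>2) +
      (norm (d k v' - scaleC \<kappa> v'))\<^sup>2 < c * (norm v')\<^sup>2"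
    by blast
  show ?case
    by (rule exI[of _ v'], rule exI[of _ "\<theta>(k := \<kappa>)"])
      (use \<theta> v' \<open>cmod \<kappa> = 1\<close> in \<open>simp add: add.assoc\<close>)
qed


text \<open>The random operators take infinitely many values, and only finitely many of them can be made to share an
  approximate eigenvector directly. Write \<open>i \<omega>\<close> for the index of a \<open>d i\<close> that is close to \<open>X \<omega>\<close> at the
  vector \<open>u\<close>. The expectation \<open>q\<close> of \<open>\<parallel>X \<omega> w - d (i \<omega>) w\<parallel>\<^sup>2\<close> is an invariant functional, relatively
  small at \<open>u\<close>, so it stays relatively small while \<open>u\<close> is turned into an approximate eigenvector \<open>w\<close> of the
  finitely many \<open>d i\<close> that matter with high probability. By Markov's inequality \<open>X \<omega> w\<close> is then close to
  \<open>d (i \<omega>) w\<close>, hence to a multiple of \<open>w\<close> by a number of modulus one.\<close>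

lemma random_almost_eigenvector:
  fixes X :: "'a \<Rightarrow> 'h::complex_hilbert_space \<Rightarrow> 'h" and d :: "nat \<Rightarrow> 'h \<Rightarrow> 'h"
  assumes "prob_space M" and R: "commuting_unitaries R"
    and X: "\<And>\<omega>. \<omega> \<in> space M \<Longrightarrow> X \<omega> \<in> R" and d: "\<And>i. d i \<in> R"
    and "u \<noteq> 0" and dense: "\<And>\<omega>. \<omega> \<in> space M \<Longrightarrow> \<exists>i. norm (X \<omega> u - d i u) < norm u / 16"
    and meas_norm [measurable]: "\<And>w v. (\<lambda>\<omega>. norm (X \<omega> w - v)) \<in> borel_measurable M"
    and meas_cinner [measurable]: "\<And>w v. (\<lambda>\<omega>. cmod (cinner (X \<omega> w) v)) \<in> borel_measurable M"
  shows "\<exists>w. w \<noteq> 0 \<and>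
    1 / 2 \<le> measure M {\<omega> \<in> space M. (norm w)\<^sup>2 / 2 \<le> cmod (cinner (X \<omega> w) w)}"
proof -
  interpret prob_space M by fact
  have uX: "unitary_operator (X \<omega>)" if "\<omega> \<in> space M" for \<omega>
    using R X[OF that] by (auto simp: commuting_unitaries_def)
  have ud: "unitary_operator (d i)" for i
    using R d by (auto simp: commuting_unitaries_def)
  define i where "i \<omega> = (LEAST i. norm (X \<omega> u - d i u) < norm u / 16)" for \<omega>
  have [measurable]: "i \<in> measurable M (count_space UNIV)"
    unfolding i_def by measurable
  have i: "norm (X \<omega> u - d (i \<omega>) u) < norm u / 16" if "\<omega> \<in> space M" for \<omega>
    unfolding i_def using dense[OF that] by (rule LeastI_ex)
  define D where "D w \<omega> = (norm (X \<omega> w - d (i \<omega>) w))\<^sup>2" for w \<omega>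
  have D_measurable [measurable]: "D w \<in> borel_measurable M" for w
  proof -
    have "(\<lambda>\<omega>. norm (X \<omega> w - d (i \<omega>) w)) \<in> borel_measurable M"
      by (rule measurable_compose_countable[where g = i]) measurable
    then show ?thesis
      unfolding D_def by measurable
  qed
  have D_le: "D w \<omega> \<le> (2 * norm w)\<^sup>2" if "\<omega> \<in> space M" for w \<omega>
    unfolding D_def using norm_triangle_ineq4[of "X \<omega> w" "d (i \<omega>) w"]
    by (intro power_mono) (simp_all add: unitary_norm[OF uX[OF that]] unitary_norm[OF ud])
  have D_nonneg: "0 \<le> D w \<omega>" for w \<omega>
    by (simp add: D_def)
  have D_int [simp]: "integrable M (D w)" for w
    by (rule integrable_const_bound[of _ "(2 * norm w)\<^sup>2"]) (use D_le D_nonneg in auto)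
  define q where "q w = (\<integral>\<omega>. D w \<omega> \<partial>M)" for w
  have q: "invariant_quadratic R q"
    unfolding invariant_quadratic_def
  proof (intro conjI ballI allI impI)
    show "0 \<le> q w" for w
      unfolding q_def using D_nonneg by simp
  next
    fix f w and \<theta> :: complex
    assume f: "f \<in> R" "cmod \<theta> = 1"
    have uf: "unitary_operator f"
      using R f by (auto simp: commuting_unitaries_def)
    have comm: "g (f x) = f (g x)" if "g \<in> R" for g x
      using R f that unfolding commuting_unitaries_def by (metis comp_apply)
    have D4: "D (f w + scaleC \<theta> w) \<omega> + D (f w - scaleC \<theta> w) \<omega> = 4 * D w \<omega>" if "\<omega> \<in> space M" for \<omega>
      unfolding D_def
      by (rule norm_parallelogram_commuting[where T = "\<lambda>w. X \<omega> w - d (i \<omega>) w", OF uf f(2)])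
        (simp_all add: unitary_add[OF uX[OF that]] unitary_scaleC[OF uX[OF that]] unitary_add[OF ud]
          unitary_scaleC[OF ud] unitary_diff[OF uf] scaleC_diff_right comm X[OF that] d)
    have "q (f w + scaleC \<theta> w) + q (f w - scaleC \<theta> w) =
        (\<integral>\<omega>. D (f w + scaleC \<theta> w) \<omega> + D (f w - scaleC \<theta> w) \<omega> \<partial>M)"
      unfolding q_def by simp
    also have "\<dots> = (\<integral>\<omega>. 4 * D w \<omega> \<partial>M)"
      using D4 by (intro Bochner_Integration.integral_cong) auto
    finally show "q (f w + scaleC \<theta> w) + q (f w - scaleC \<theta> w) = 4 * q w"
      unfolding q_def by simp
  qed
  \<comment> \<open>The level \<open>1/64\<close> serves two purposes: relative to \<open>\<parallel>w\<parallel>\<close> the eigenvector defects come out below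
    \<open>1/8\<close>, and Markov's inequality bounds the probability that \<open>X \<omega> w\<close> is at distance at least \<open>1/4\<close>
    from \<open>d (i \<omega>) w\<close> by \<open>(1/64) / (1/16) = 1/4\<close>.\<close>
  have "q u \<le> (\<integral>\<omega>. (norm u / 16)\<^sup>2 \<partial>M)"
    unfolding q_def
  proof (rule integral_mono)
    show "D u \<omega> \<le> (norm u / 16)\<^sup>2" if "\<omega> \<in> space M" for \<omega>
      unfolding D_def using i[OF that] by (intro power_mono) auto
  qed auto
  also have "\<dots> < 1 / 64 * (norm u)\<^sup>2"
    using \<open>u \<noteq> 0\<close> by (simp add: power_divide prob_space)
  finally have q_u: "q u < 1 / 64 * (norm u)\<^sup>2" .
  have "(\<lambda>k. measure M {\<omega> \<in> space M. i \<omega> < k}) \<longlonglongrightarrow> measure M (\<Union>k. {\<omega> \<in> space M. i \<omega> < k})"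
    by (rule finite_Lim_measure_incseq) (auto simp: incseq_def)
  moreover have "(\<Union>k. {\<omega> \<in> space M. i \<omega> < k}) = space M"
    by auto
  ultimately have "(\<lambda>k. measure M {\<omega> \<in> space M. i \<omega> < k}) \<longlonglongrightarrow> 1"
    by (simp add: prob_space)
  from order_tendstoD(1)[OF this, of "3 / 4"]
  have "eventually (\<lambda>k. 3 / 4 < measure M {\<omega> \<in> space M. i \<omega> < k}) sequentially"
    by simp
  from eventually_happens'[OF sequentially_bot this]
  obtain k where k: "3 / 4 < measure M {\<omega> \<in> space M. i \<omega> < k}"
    by (elim exE)
  obtain w \<theta> where \<theta>: "\<And>i. cmod (\<theta> i) = 1"
    and w: "q w + (\<Sum>i<k. (norm (d i w - scaleC (\<theta> i) w))\<^sup>2) < 1 / 64 * (norm w)\<^sup>2"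
    using approximate_joint_eigenvector[where d = d and k = k, OF R q d q_u] by auto
  have q_nonneg: "0 \<le> q w"
    unfolding q_def using D_nonneg by simp
  have sum_nonneg: "0 \<le> (\<Sum>i<k. (norm (d i w - scaleC (\<theta> i) w))\<^sup>2)"
    by (intro sum_nonneg) simp
  have "w \<noteq> 0"
    using w q_nonneg sum_nonneg by auto
  have q_w: "q w < 1 / 64 * (norm w)\<^sup>2"
    using w sum_nonneg by simp
  have eigen: "norm (d j w - scaleC (\<theta> j) w) < norm w / 8" if "j < k" for j
  proof -
    have "(norm (d j w - scaleC (\<theta> j) w))\<^sup>2 \<le> (\<Sum>i<k. (norm (d i w - scaleC (\<theta> i) w))\<^sup>2)"
      using that by (intro member_le_sum) auto
    then have "(norm (d j w - scaleC (\<theta> j) w))\<^sup>2 < (norm w / 8)\<^sup>2"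
      using w q_nonneg by (simp add: power_divide)
    then show ?thesis
      by (rule power_less_imp_less_base) simp
  qed
  define Bad where "Bad = {\<omega> \<in> space M. (norm w / 4)\<^sup>2 \<le> D w \<omega>}"
  have [measurable]: "Bad \<in> sets M"
    unfolding Bad_def by measurable
  have "measure M Bad \<le> q w / (norm w / 4)\<^sup>2"
    unfolding Bad_def q_def
    by (rule integral_Markov_inequality_measure[where A = "space M"]) (use D_nonneg \<open>w \<noteq> 0\<close> in auto)
  also have "\<dots> < 1 / 4"
    using q_w \<open>w \<noteq> 0\<close> by (simp add: field_simps power_divide)
  finally have Bad: "measure M Bad < 1 / 4" .
  have good: "(norm w)\<^sup>2 / 2 \<le> cmod (cinner (X \<omega> w) w)" if \<omega>: "\<omega> \<in> space M" "i \<omega> < k" "\<omega> \<notin> Bad" for \<omega>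
  proof -
    let ?v = "X \<omega> w - scaleC (\<theta> (i \<omega>)) w"
    have "D w \<omega> < (norm w / 4)\<^sup>2"
      using \<omega> by (simp add: Bad_def)
    then have "norm (X \<omega> w - d (i \<omega>) w) < norm w / 4"
      unfolding D_def by (rule power_less_imp_less_base) simp
    moreover have "norm ?v \<le> norm (X \<omega> w - d (i \<omega>) w) + norm (d (i \<omega>) w - scaleC (\<theta> (i \<omega>)) w)"
      using norm_triangle_ineq[of "X \<omega> w - d (i \<omega>) w" "d (i \<omega>) w - scaleC (\<theta> (i \<omega>)) w"] by simp
    ultimately have "norm ?v \<le> norm w / 2"
      using eigen[OF \<omega>(2)] norm_ge_zero[of w] by linarith
    then have "norm ?v * norm w \<le> norm w / 2 * norm w"
      by (rule mult_right_mono) simp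
    with cmod_cinner_le[of ?v w] have *: "cmod (cinner ?v w) \<le> (norm w)\<^sup>2 / 2"
      by (simp add: power2_eq_square)
    have "cinner (X \<omega> w) w - cinner ?v w = \<theta> (i \<omega>) * complex_of_real ((norm w)\<^sup>2)"
      by (simp add: cinner_diff_left cinner_scaleC_left cinner_self)
    then have "cmod (cinner (X \<omega> w) w - cinner ?v w) = (norm w)\<^sup>2"
      by (simp add: norm_mult \<theta> del: of_real_power)
    with * norm_triangle_ineq4[of "cinner (X \<omega> w) w" "cinner ?v w"] show ?thesis
      by simp
  qed
  have "1 / 2 \<le> measure M {\<omega> \<in> space M. i \<omega> < k} - measure M Bad"
    using k Bad by simp
  also have "\<dots> \<le> measure M ({\<omega> \<in> space M. i \<omega> < k} - Bad)"
    using measure_Un_le[of "{\<omega> \<in> space M. i \<omega> < k} - Bad" M Bad]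
      finite_measure_mono[of "{\<omega> \<in> space M. i \<omega> < k}" "{\<omega> \<in> space M. i \<omega> < k} - Bad \<union> Bad"]
    by simp
  also have "\<dots> \<le> measure M {\<omega> \<in> space M. (norm w)\<^sup>2 / 2 \<le> cmod (cinner (X \<omega> w) w)}"
    by (rule finite_measure_mono) (use good in auto)
  finally show ?thesis
    using \<open>w \<noteq> 0\<close> by blast
qed

section \<open>Measurability of the random walk\<close>

text \<open>Second countable spaces are first countable, so a second countable instance of \<open>vec\<close> presupposes a first
  countable one at arguments that need not be metric.\<close>

instance vec :: (first_countable_topology, finite) first_countable_topology
proof
  fix x :: "'a ^ 'b"
  have "\<exists>\<A>. countable \<A> \<and> (\<forall>A\<in>\<A>. x $ i \<in> A \<and> open A) \<and>
      (\<forall>S. open S \<longrightarrow> x $ i \<in> S \<longrightarrow> (\<exists>A\<in>\<A>. A \<subseteq> S))" for i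
    by (rule first_countable_basisE[of "x $ i"]) blast
  then obtain \<A> where \<A>: "\<And>i. countable (\<A> i)" "\<And>i. \<forall>A\<in>\<A> i. x $ i \<in> A \<and> open A"
      "\<And>i. \<forall>S. open S \<longrightarrow> x $ i \<in> S \<longrightarrow> (\<exists>A\<in>\<A> i. A \<subseteq> S)"
    by metis
  define box where "box F = {x :: 'a ^ 'b. \<forall>i. x $ i \<in> F i}" for F
  show "\<exists>\<A>::nat \<Rightarrow> ('a ^ 'b) set.
      (\<forall>i. x \<in> \<A> i \<and> open (\<A> i)) \<and> (\<forall>S. open S \<and> x \<in> S \<longrightarrow> (\<exists>i. \<A> i \<subseteq> S))"
  proof (rule first_countableI)
    show "countable (box ` Pi\<^sub>E UNIV \<A>)"
      by (intro countable_image countable_PiE \<A>) simp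
    show "x \<in> S" if "S \<in> box ` Pi\<^sub>E UNIV \<A>" for S
      using that \<A>(2) by (auto simp: box_def PiE_iff)
    show "open S" if "S \<in> box ` Pi\<^sub>E UNIV \<A>" for S
      using that \<A>(2) by (auto simp: box_def PiE_iff intro!: open_vector_box)
  next
    fix S assume "open S" "x \<in> S"
    then obtain A where A: "\<And>i. open (A i)" "\<And>i. x $ i \<in> A i" "\<And>y. (\<And>i. y $ i \<in> A i) \<Longrightarrow> y \<in> S"
      unfolding open_vec_def by metis
    obtain F where F: "\<And>i. F i \<in> \<A> i" "\<And>i. F i \<subseteq> A i"
      using \<A>(3)[rule_format, OF A(1,2)] by metis
    show "\<exists>B\<in>box ` Pi\<^sub>E UNIV \<A>. B \<subseteq> S"
    proof (intro bexI[of _ "box F"] imageI subsetI)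
      show "y \<in> S" if "y \<in> box F" for y
        using that F(2) by (intro A(3)) (auto simp: box_def)
      show "F \<in> Pi\<^sub>E UNIV \<A>"
        using F by (simp add: PiE_iff)
    qed
  qed
qed

instance vec :: (second_countable_topology, finite) second_countable_topology
proof
  obtain B :: "'a set set" where B: "countable B" "topological_basis B"
    using ex_countable_basis by (elim exE conjE)
  define box where "box F = {x :: 'a ^ 'b. \<forall>i. x $ i \<in> F i}" for F
  have "countable (box ` Pi\<^sub>E UNIV (\<lambda>_. B))"
    by (intro countable_image countable_PiE B) simp
  moreover have "topological_basis (box ` Pi\<^sub>E UNIV (\<lambda>_. B))"
  proof (rule topological_basisI)
    show "open S" if "S \<in> box ` Pi\<^sub>E UNIV (\<lambda>_. B)" for S
      using that topological_basis_open[OF B(2)]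
      by (auto simp: box_def PiE_iff intro!: open_vector_box)
  next
    fix S and x :: "'a ^ 'b" assume "open S" "x \<in> S"
    then obtain A where A: "\<And>i. open (A i)" "\<And>i. x $ i \<in> A i" "\<And>y. (\<And>i. y $ i \<in> A i) \<Longrightarrow> y \<in> S"
      unfolding open_vec_def by metis
    have "\<exists>V\<in>B. x $ i \<in> V \<and> V \<subseteq> A i" for i
      using topological_basisE[OF B(2) A(1,2)] by (metis)
    then obtain F where F: "\<And>i. F i \<in> B" "\<And>i. x $ i \<in> F i" "\<And>i. F i \<subseteq> A i"
      by metis
    show "\<exists>b\<in>box ` Pi\<^sub>E UNIV (\<lambda>_. B). x \<in> b \<and> b \<subseteq> S"
    proof (intro bexI[of _ "box F"] conjI imageI subsetI)
      show "x \<in> box F"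
        using F by (simp add: box_def)
      show "y \<in> S" if "y \<in> box F" for y
        using that F(3) by (intro A(3)) (auto simp: box_def)
      show "F \<in> Pi\<^sub>E UNIV (\<lambda>_. B)"
        using F by (simp add: PiE_iff)
    qed
  qed
  ultimately show "\<exists>B::('a ^ 'b) set set. countable B \<and> open = generate_topology B"
    by (intro exI[of _ "box ` Pi\<^sub>E UNIV (\<lambda>_. B)"] conjI topological_basis_imp_subbasis)
qed

lemma space_borel_of: "space (borel_of T) = topspace T"
  unfolding borel_of_def by (rule space_measure_of) (auto dest: openin_subset)

lemma borel_of_measurable_continuous_on:
  assumes "continuous_on S h"
  shows "h \<in> borel_measurable (borel_of (top_of_set S))"
proof (rule borel_measurableI)
  fix U :: "'b set" assume "open U"
  have "openin (top_of_set S) (S \<inter> h -` U)"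
    using assms \<open>open U\<close> by (rule continuous_openin_preimage_gen)
  then have "S \<inter> h -` U \<in> sets (borel_of (top_of_set S))"
    unfolding borel_of_def by (subst sets_measure_of) (auto dest: openin_imp_subset)
  then show "h -` U \<inter> space (borel_of (top_of_set S)) \<in> sets (borel_of (top_of_set S))"
    by (simp add: space_borel_of Int_commute)
qed

lemma measurable_borel_of_top_of_set:
  assumes g: "g \<in> borel_measurable M" and S: "\<And>\<omega>. \<omega> \<in> space M \<Longrightarrow> g \<omega> \<in> S"
  shows "g \<in> measurable M (borel_of (top_of_set S))"
  unfolding borel_of_def
proof (rule measurable_measure_of)
  show "g -` U \<inter> space M \<in> sets M" if U: "U \<in> {U. openin (top_of_set S) U}" for U
  proof -
    obtain V where V: "open V" "U = S \<inter> V"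
      using U by (auto simp: openin_open)
    have "g -` U \<inter> space M = g -` V \<inter> space M"
      using S V by auto
    then show ?thesis
      using measurable_sets[OF g borel_open[OF V(1)]] by simp
  qed
qed (use S in \<open>auto dest: openin_imp_subset\<close>)

lemma scaling_group_topology_eq:
  "(scaling_group_topology :: ('k::local_field \<times> ('k ^ 'n)) topology) = top_of_set ((- {0}) \<times> UNIV)"
  unfolding scaling_group_topology_def
  using subtopology_Times[of "euclidean :: 'k topology" "euclidean :: ('k ^ 'n) topology" "- {0}" UNIV]
  by (simp add: euclidean_product_topology)

lemma carrier_scaling_group: "carrier scaling_group = (- {0}) \<times> UNIV"
  by (simp add: scaling_group_def)

lemma mult_scaling_group: "(a, x) \<otimes>\<^bsub>scaling_group\<^esub> (b, y) = (a * b, x + a *s y)"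
  by (simp add: scaling_group_def)

lemma one_scaling_group: "\<one>\<^bsub>scaling_group\<^esub> = (1, 0)"
  by (simp add: scaling_group_def)

lemma continuous_on_scaling_mult:
  "continuous_on UNIV (\<lambda>p :: ('k \<times> ('k ^ 'n)) \<times> ('k::local_field \<times> ('k ^ 'n)).
     fst p \<otimes>\<^bsub>scaling_group\<^esub> snd p)"
proof -
  have "fst p \<otimes>\<^bsub>scaling_group\<^esub> snd p =
      (fst (fst p) * fst (snd p), \<chi> i. snd (fst p) $ i + fst (fst p) * snd (snd p) $ i)"
    for p :: "('k \<times> ('k ^ 'n)) \<times> ('k \<times> ('k ^ 'n))"
    by (cases p) (auto simp: mult_scaling_group vec_eq_iff)
  then show ?thesis
    unfolding continuous_on_def
    by (simp only:) (intro ballI tendsto_intros)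
qed

lemma random_walk_in_carrier:
  assumes "monoid G" "\<And>i. \<omega> i \<in> carrier G"
  shows "random_walk G \<omega> m \<in> carrier G"
  using assms by (induction m) (auto intro: monoid.m_closed)

text \<open>Second countability enters here: it makes the continuous multiplication measurable for the product
  of the Borel \<open>\<sigma>\<close>-algebras.\<close>

lemma random_walk_measurable:
  fixes \<mu> :: "('k::local_field \<times> ('k ^ 'n)) measure"
  assumes sets: "sets \<mu> = sets (borel_of scaling_group_topology)"
    and group: "monoid (scaling_group :: ('k \<times> ('k ^ 'n)) monoid)"
  shows "(\<lambda>\<omega>. random_walk scaling_group \<omega> m)
    \<in> measurable (\<Pi>\<^sub>M i\<in>(UNIV :: nat set). \<mu>) (borel_of scaling_group_topology)"
    (is "_ \<in> measurable ?M ?B")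
proof (induction m)
  case 0
  show ?case
    by (simp add: space_borel_of scaling_group_topology_eq one_scaling_group)
next
  case (Suc m)
  have space: "space \<mu> = carrier scaling_group"
    using sets_eq_imp_space_eq[OF sets]
    by (simp add: space_borel_of scaling_group_topology_eq carrier_scaling_group)
  have id: "(\<lambda>x. x) \<in> borel_measurable ?B"
    unfolding scaling_group_topology_eq
    by (intro borel_of_measurable_continuous_on continuous_intros)
  have "(\<lambda>\<omega>. \<omega> m) \<in> measurable ?M \<mu>"
    by (rule measurable_component_singleton) simp
  then have "(\<lambda>\<omega>. \<omega> m) \<in> measurable ?M ?B"
    unfolding measurable_cong_sets[OF refl sets] .
  then have 1: "(\<lambda>\<omega>. \<omega> m) \<in> borel_measurable ?M"
    by (rule measurable_compose[OF _ id])
  have 2: "(\<lambda>\<omega>. random_walk scaling_group \<omega> m) \<in> borel_measurable ?M"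
    by (rule measurable_compose[OF Suc id])
  have "(\<lambda>\<omega>. random_walk scaling_group \<omega> (Suc m)) \<in> borel_measurable ?M"
    using borel_measurable_continuous_Pair[OF 1 2 continuous_on_scaling_mult] by simp
  then show ?case
    unfolding scaling_group_topology_eq
  proof (rule measurable_borel_of_top_of_set)
    fix \<omega> assume "\<omega> \<in> space ?M"
    then have "\<omega> i \<in> carrier scaling_group" for i
      using space by (auto simp: space_PiM)
    from random_walk_in_carrier[OF group this]
    show "random_walk scaling_group \<omega> (Suc m) \<in> (- {0}) \<times> UNIV"
      unfolding carrier_scaling_group .
  qed
qed

section \<open>Uniform boundedness of matrix coefficients\<close>

lemma truncated_integral_tendsto:
  fixes X :: "nat \<Rightarrow> 'a \<Rightarrow> real"
  assumes "prob_space M" and X: "\<And>n. X n \<in> borel_measurable M" "Y \<in> borel_measurable M"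
    and nonneg: "\<And>n \<omega>. 0 \<le> X n \<omega>"
    and lim: "\<And>\<omega>. \<omega> \<in> space M \<Longrightarrow> (\<lambda>n. X n \<omega>) \<longlonglongrightarrow> Y \<omega>"
  shows "(\<lambda>n. \<integral>\<omega>. min 1 (X n \<omega>) \<partial>M) \<longlonglongrightarrow> (\<integral>\<omega>. min 1 (Y \<omega>) \<partial>M)"
proof (rule integral_dominated_convergence)
  interpret prob_space M by fact
  show "integrable M (\<lambda>_. 1 :: real)"
    by simp
  show "AE \<omega> in M. (\<lambda>n. min 1 (X n \<omega>)) \<longlonglongrightarrow> min 1 (Y \<omega>)"
    using lim by (intro AE_I2 tendsto_min tendsto_const)
  show "AE \<omega> in M. norm (min 1 (X n \<omega>)) \<le> 1" for n
    using nonneg[of n] by (intro AE_I2) (auto simp: min_def)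
qed (use X in measurable)

lemma bounded_if_limsup_finite:
  fixes x a :: "nat \<Rightarrow> real"
  assumes "limsup (\<lambda>m. ereal (x m / a m)) < \<infinity>" and pos: "\<And>m. m \<ge> 1 \<Longrightarrow> 0 < a m"
  shows "\<exists>C. \<forall>m\<ge>1. x m \<le> C * a m"
proof -
  obtain c :: real where c: "limsup (\<lambda>m. ereal (x m / a m)) < ereal c"
    using ereal_dense2[OF assms(1)] by blast
  from Limsup_lessD[OF c] obtain N where N: "\<And>m. m \<ge> N \<Longrightarrow> x m / a m < c"
    by (auto simp: eventually_sequentially)
  have "x m / a m \<le> \<bar>c\<bar> + (\<Sum>j<N. \<bar>x j / a j\<bar>)" for m
  proof (cases "m < N")
    case True
    then have "\<bar>x m / a m\<bar> \<le> (\<Sum>j<N. \<bar>x j / a j\<bar>)"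
      by (intro member_le_sum) auto
    then show ?thesis
      by linarith
  next
    case False
    moreover have "0 \<le> (\<Sum>j<N. \<bar>x j / a j\<bar>)"
      by (intro sum_nonneg) simp
    ultimately show ?thesis
      using N[of m] by linarith
  qed
  then have "\<forall>m\<ge>1. x m \<le> (\<bar>c\<bar> + (\<Sum>j<N. \<bar>x j / a j\<bar>)) * a m"
    using pos by (simp add: divide_le_eq)
  then show ?thesis ..
qed

text \<open>For each \<open>k\<close> the pairs \<open>(u, v)\<close> for which the truncated expectations with \<open>C = k + 1\<close> are at most
  \<open>\<epsilon>/4\<close>, for all \<open>m\<close> at once, form a closed set. Almost sure boundedness says that these sets cover
  \<open>H \<times> H\<close>, so by Baire's theorem one of them contains a ball. Every coefficient at small \<open>u, v\<close> is a
  combination of the four coefficients at the corners \<open>u0, u0 + u\<close> and \<open>v0, v0 + v\<close> in this ball, and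
  truncation is subadditive. The truncated expectation is preferred to the probability of a large
  coefficient because it depends continuously on \<open>u\<close> and \<open>v\<close>.\<close>

lemma truncated_coefficients_uniformly_small:
  fixes U :: "nat \<Rightarrow> 'a \<Rightarrow> 'h::complex_hilbert_space \<Rightarrow> 'h" and a :: "nat \<Rightarrow> real"
  assumes "prob_space M"
    and unitary: "\<And>m \<omega>. \<omega> \<in> space M \<Longrightarrow> unitary_operator (U m \<omega>)"
    and meas: "\<And>m u v. (\<lambda>\<omega>. cmod (cinner (U m \<omega> u) v)) \<in> borel_measurable M"
    and pos: "\<And>m. m \<ge> 1 \<Longrightarrow> 0 < a m"
    and bounded: "\<And>u v. AE \<omega> in M. \<exists>C. \<forall>m\<ge>1. cmod (cinner (U m \<omega> u) v) \<le> C * a m"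
    and "0 < \<epsilon>"
  shows "\<exists>C>0. \<exists>r>0. \<forall>m\<ge>1. \<forall>u v. norm u < r \<longrightarrow> norm v < r \<longrightarrow>
    (\<integral>\<omega>. min 1 (cmod (cinner (U m \<omega> u) v) / (C * a m)) \<partial>M) \<le> \<epsilon>"
proof -
  interpret prob_space M by fact
  note [measurable] = meas
  define I where "I C m p = (\<integral>\<omega>. min 1 (cmod (cinner (U m \<omega> (fst p)) (snd p)) / (C * a m)) \<partial>M)"
    for C m and p :: "'h \<times> 'h"
  have integrable: "integrable M (\<lambda>\<omega>. min 1 (cmod (cinner (U m \<omega> u) v) / c))" if "0 \<le> c" for m u v c
    by (rule integrable_const_bound[of _ 1]) (use that in \<open>auto simp: min_def\<close>)
  have continuous: "continuous_on UNIV (I C m)" if "0 < C" "1 \<le> m" for C m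
    unfolding continuous_on_sequentially
  proof (intro allI ballI impI, elim conjE)
    fix p :: "nat \<Rightarrow> 'h \<times> 'h" and p0 assume p: "p \<longlonglongrightarrow> p0"
    have "(\<lambda>n. cmod (cinner (U m \<omega> (fst (p n))) (snd (p n))) / (C * a m))
        \<longlonglongrightarrow> cmod (cinner (U m \<omega> (fst p0)) (snd p0)) / (C * a m)" if "\<omega> \<in> space M" for \<omega>
      using p pos[OF \<open>1 \<le> m\<close>] \<open>0 < C\<close>
      by (intro tendsto_divide tendsto_norm tendsto_cinner unitary_tendsto[OF unitary[OF that]]
          tendsto_fst tendsto_snd tendsto_const) auto
    then show "(I C m \<circ> p) \<longlonglongrightarrow> I C m p0"
      unfolding I_def comp_def using pos[OF \<open>1 \<le> m\<close>] \<open>0 < C\<close>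
      by (intro truncated_integral_tendsto) (auto simp: prob_space_axioms)
  qed
  define E where "E k = {p. \<forall>m\<ge>1. I (real (Suc k)) m p \<le> \<epsilon> / 4}" for k
  have closed: "closed (E k)" for k
  proof -
    have "E k = (\<Inter>m\<in>{1..}. {p. I (real (Suc k)) m p \<le> \<epsilon> / 4})"
      unfolding E_def by auto
    then show ?thesis
      by (simp only:) (intro closed_INT ballI closed_Collect_le continuous continuous_on_const, auto)
  qed
  have cover: "\<exists>k. p \<in> E k" for p
  proof -
    obtain u v where p: "p = (u, v)"
      by (rule prod.exhaust)
    define B where "B k = {\<omega> \<in> space M. \<forall>m\<in>{1..}. cmod (cinner (U m \<omega> u) v) \<le> real (Suc k) * a m}" for k
    have B [measurable]: "B k \<in> sets M" for k
      unfolding B_def by measurable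
    have mono: "real (Suc k) * a m \<le> real (Suc l) * a m" if "k \<le> l" "1 \<le> m" for k l m
      using that pos[of m] by (intro mult_right_mono) auto
    have "incseq B"
      unfolding incseq_def B_def using mono by (auto intro: order_trans)
    have "AE \<omega> in M. \<omega> \<in> (\<Union>k. B k)"
      using bounded[of u v]
    proof (rule AE_mp, intro AE_I2 impI)
      fix \<omega> assume \<omega>: "\<omega> \<in> space M" and "\<exists>C. \<forall>m\<ge>1. cmod (cinner (U m \<omega> u) v) \<le> C * a m"
      then obtain C where C: "\<And>m. m \<ge> 1 \<Longrightarrow> cmod (cinner (U m \<omega> u) v) \<le> C * a m"
        by auto
      obtain k where k: "C \<le> real k"
        using real_arch_simple by blast
      have "C * a m \<le> real (Suc k) * a m" if "1 \<le> m" for m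
        using k pos[OF that] by (intro mult_right_mono) auto
      then have "\<omega> \<in> B k"
        using \<omega> C by (auto simp: B_def intro: order_trans)
      then show "\<omega> \<in> (\<Union>k. B k)"
        by blast
    qed
    then have "prob (\<Union>k. B k) = 1"
      by (subst prob_eq_1) auto
    moreover have "(\<lambda>k. prob (B k)) \<longlonglongrightarrow> prob (\<Union>k. B k)"
      using B \<open>incseq B\<close> by (intro finite_Lim_measure_incseq) auto
    ultimately have lim: "(\<lambda>k. prob (B k)) \<longlonglongrightarrow> 1"
      by simp
    have "eventually (\<lambda>k. 1 - \<epsilon> / 8 < prob (B k)) sequentially"
      by (rule order_tendstoD(1)[OF lim]) (use \<open>0 < \<epsilon>\<close> in simp)
    from eventually_happens'[OF sequentially_bot this]
    obtain k where k: "1 - \<epsilon> / 8 < prob (B k)"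
      by (elim exE)
    \<comment> \<open>On \<open>B k\<close> the quotients are at most \<open>\<epsilon>/8\<close> for this \<open>l\<close>, and off \<open>B k\<close>, an event of probability less than
      \<open>\<epsilon>/8\<close>, the truncation bounds them by \<open>1\<close>.\<close>
    obtain l :: nat where l: "real (Suc k) / (\<epsilon> / 8) \<le> real l"
      using real_arch_simple by blast
    have "I (real (Suc l)) m p \<le> \<epsilon> / 4" if m: "m \<ge> 1" for m
    proof -
      let ?g = "\<lambda>\<omega>. \<epsilon> / 8 + indicator (space M - B k) \<omega> :: real"
      have small: "cmod (cinner (U m \<omega> u) v) / (real (Suc l) * a m) \<le> \<epsilon> / 8" if "\<omega> \<in> B k" for \<omega>
      proof -
        have "cmod (cinner (U m \<omega> u) v) \<le> real (Suc k) * a m"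
          using that m by (simp add: B_def)
        also have "\<dots> \<le> (\<epsilon> / 8 * real (Suc l)) * a m"
          using l \<open>0 < \<epsilon>\<close> pos[OF m] by (intro mult_right_mono) (auto simp: field_simps)
        finally show ?thesis
          using pos[OF m] by (simp add: divide_le_eq mult.assoc)
      qed
      have "I (real (Suc l)) m p \<le> (\<integral>\<omega>. ?g \<omega> \<partial>M)"
        unfolding I_def p fst_conv snd_conv
      proof (rule integral_mono)
        show "integrable M (\<lambda>\<omega>. min 1 (cmod (cinner (U m \<omega> u) v) / (real (Suc l) * a m)))"
          using pos[OF m] by (intro integrable) simp
        show "integrable M ?g"
          by (rule integrable_const_bound[of _ "\<epsilon> / 8 + 1"])
            (use \<open>0 < \<epsilon>\<close> in \<open>auto simp: indicator_def\<close>)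
        show "min 1 (cmod (cinner (U m \<omega> u) v) / (real (Suc l) * a m)) \<le> ?g \<omega>" if "\<omega> \<in> space M" for \<omega>
        proof (cases "\<omega> \<in> B k")
          case True
          then show ?thesis
            using order_trans[OF min.cobounded2 small[OF True], of 1] True by simp
        next
          case False
          then show ?thesis
            using that \<open>0 < \<epsilon>\<close> by (simp add: min.coboundedI1)
        qed
      qed
      also have "\<dots> = \<epsilon> / 8 + prob (space M - B k)"
        using B[of k] by (subst Bochner_Integration.integral_add)
          (auto simp: prob_space Int_absorb2 less_top[symmetric] intro!: integrable_real_indicator)
      also have "prob (space M - B k) < \<epsilon> / 8"
        using k by (simp add: prob_compl)
      finally show ?thesis
        by simp
    qed
    then have "p \<in> E l"
      by (simp add: E_def)
    then show ?thesis ..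
  qed
  have "\<exists>k. interior (E k) \<noteq> {}"
  proof (rule ccontr)
    assume "\<nexists>k. interior (E k) \<noteq> {}"
    then have "euclidean interior_of \<Union>(range E) = {}"
      using closed
      by (intro Baire_category_alt disjI1 completely_metrizable_space_euclidean)
        (auto)
    moreover have "\<Union>(range E) = UNIV"
      using cover by auto
    ultimately show False
      by (simp)
  qed
  then obtain k p where "p \<in> interior (E k)"
    by auto
  then obtain r where r: "0 < r" "ball p r \<subseteq> E k"
    using mem_interior by blast
  obtain u0 v0 where p: "p = (u0, v0)"
    by (rule prod.exhaust)
  have "(\<integral>\<omega>. min 1 (cmod (cinner (U m \<omega> u) v) / (real (Suc k) * a m)) \<partial>M) \<le> \<epsilon>"
    if m: "1 \<le> m" and uv: "norm u < r / 2" "norm v < r / 2" for m u v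
  proof -
    let ?c = "real (Suc k) * a m"
    let ?t = "\<lambda>u v \<omega>. min 1 (cmod (cinner (U m \<omega> u) v) / ?c)"
    have "0 < ?c"
      using pos[OF m] by simp
    have corner: "(\<integral>\<omega>. ?t (u0 + x) (v0 + y) \<omega> \<partial>M) \<le> \<epsilon> / 4" if "norm x < r / 2" "norm y < r / 2" for x y
    proof -
      have "norm (x, y) < r"
        using that norm_Pair_le[of x y] by simp
      then have "(u0 + x, v0 + y) \<in> ball p r"
        by (simp add: p dist_norm norm_minus_commute norm_Pair)
      then show ?thesis
        using r m by (auto simp: E_def I_def)
    qed
    have int [simp]: "integrable M (?t x y)" for x y
      using \<open>0 < ?c\<close> by (intro integrable) simp
    have "(\<integral>\<omega>. ?t u v \<omega> \<partial>M) \<le>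
        (\<integral>\<omega>. ?t (u0 + u) (v0 + v) \<omega> + ?t (u0 + u) (v0 + 0) \<omega> + ?t (u0 + 0) (v0 + v) \<omega> +
          ?t (u0 + 0) (v0 + 0) \<omega> \<partial>M)"
    proof (rule integral_mono)
      fix \<omega> assume "\<omega> \<in> space M"
      then have "U m \<omega> (u0 + u) = U m \<omega> u0 + U m \<omega> u"
        using unitary_add[OF unitary] by blast
      then have eq: "cinner (U m \<omega> u) v = (cinner (U m \<omega> (u0 + u)) (v0 + v) - cinner (U m \<omega> (u0 + u)) (v0 + 0))
          - (cinner (U m \<omega> (u0 + 0)) (v0 + v) - cinner (U m \<omega> (u0 + 0)) (v0 + 0))"
        by (simp add: cinner_add_left cinner_add_right)
      have "cmod (cinner (U m \<omega> u) v) \<le>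
          (cmod (cinner (U m \<omega> (u0 + u)) (v0 + v)) + cmod (cinner (U m \<omega> (u0 + u)) (v0 + 0))) +
          (cmod (cinner (U m \<omega> (u0 + 0)) (v0 + v)) + cmod (cinner (U m \<omega> (u0 + 0)) (v0 + 0)))"
        unfolding eq by (intro order_trans[OF norm_triangle_ineq4] add_mono norm_triangle_ineq4)
      from divide_right_mono[OF this less_imp_le[OF \<open>0 < ?c\<close>]]
      have "cmod (cinner (U m \<omega> u) v) / ?c \<le>
          cmod (cinner (U m \<omega> (u0 + u)) (v0 + v)) / ?c + cmod (cinner (U m \<omega> (u0 + u)) (v0 + 0)) / ?c +
          cmod (cinner (U m \<omega> (u0 + 0)) (v0 + v)) / ?c + cmod (cinner (U m \<omega> (u0 + 0)) (v0 + 0)) / ?c"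
        by (simp only: add_divide_distrib add.assoc)
      moreover have "min 1 s \<le> min 1 x + min 1 y + min 1 z + min 1 w"
        if "s \<le> x + y + z + w" "0 \<le> x" "0 \<le> y" "0 \<le> z" "0 \<le> w" for s x y z w :: real
        using that by (auto simp: min_def)
      ultimately show "?t u v \<omega> \<le> ?t (u0 + u) (v0 + v) \<omega> + ?t (u0 + u) (v0 + 0) \<omega> +
          ?t (u0 + 0) (v0 + v) \<omega> + ?t (u0 + 0) (v0 + 0) \<omega>"
        using \<open>0 < ?c\<close> by simp
    qed (intro Bochner_Integration.integrable_add int)+
    also have "\<dots> = (\<integral>\<omega>. ?t (u0 + u) (v0 + v) \<omega> \<partial>M) + (\<integral>\<omega>. ?t (u0 + u) (v0 + 0) \<omega> \<partial>M) +
        (\<integral>\<omega>. ?t (u0 + 0) (v0 + v) \<omega> \<partial>M) + (\<integral>\<omega>. ?t (u0 + 0) (v0 + 0) \<omega> \<partial>M)"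
      using int by (simp only: Bochner_Integration.integral_add Bochner_Integration.integrable_add)
    also have "\<dots> \<le> \<epsilon> / 4 + \<epsilon> / 4 + \<epsilon> / 4 + \<epsilon> / 4"
      using uv r by (intro add_mono corner) auto
    finally show ?thesis
      by simp
  qed
  then show ?thesis
    using r by (intro exI[of _ "real (Suc k)"] exI[of _ "r / 2"] conjI) auto
qed


section \<open>Representations of the scaling group\<close>

lemma scaling_group_unitary_representation:
  fixes \<pi> :: "'k::local_field \<times> ('k ^ 'n) \<Rightarrow> 'h::complex_hilbert_space \<Rightarrow> 'h"
  assumes "unitary_representation scaling_group scaling_group_topology \<pi>"
  shows scaling_rep_unitary: "\<And>a x. a \<noteq> 0 \<Longrightarrow> unitary_operator (\<pi> (a, x))"
    and scaling_rep_mult: "\<And>a x b y u. a \<noteq> 0 \<Longrightarrow> b \<noteq> 0 \<Longrightarrow> \<pi> (a, x) (\<pi> (b, y) u) = \<pi> (a * b, x + a *s y) u"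
    and scaling_rep_continuous: "\<And>u. continuous_on ((- {0}) \<times> UNIV) (\<lambda>g. \<pi> g u)"
proof -
  show "unitary_operator (\<pi> (a, x))" if "a \<noteq> 0" for a x
    using assms that by (simp add: unitary_representation_def carrier_scaling_group)
  show "\<pi> (a, x) (\<pi> (b, y) u) = \<pi> (a * b, x + a *s y) u" if "a \<noteq> 0" "b \<noteq> 0" for a x b y u
  proof -
    have "\<pi> ((a, x) \<otimes>\<^bsub>scaling_group\<^esub> (b, y)) = \<pi> (a, x) \<circ> \<pi> (b, y)"
      using assms that by (simp add: unitary_representation_def carrier_scaling_group)
    then show ?thesis
      by (simp add: mult_scaling_group fun_eq_iff)
  qed
  show "continuous_on ((- {0}) \<times> UNIV) (\<lambda>g. \<pi> g u)" for u
    using assms by (simp add: unitary_representation_def scaling_group_topology_eq)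
qed

text \<open>Since \<open>(a, x) (t\<^sup>-\<^sup>n, 0) = (t\<^sup>-\<^sup>n, 0) (a, t\<^sup>n x)\<close> and \<open>\<pi> (t\<^sup>-\<^sup>n, 0)\<close> is unitary, the \<open>n\<close>-th coefficient is
  that of \<open>\<pi> (a, t\<^sup>n x)\<close> at \<open>u, v\<close>.\<close>

lemma dilation_limit_of_coefficient:
  fixes \<pi> :: "'k::local_field \<times> ('k ^ 'n) \<Rightarrow> 'h::complex_hilbert_space \<Rightarrow> 'h"
  assumes \<pi>: "unitary_representation scaling_group scaling_group_topology \<pi>"
    and "a \<noteq> 0" "t \<noteq> 0" and t: "(\<lambda>n. t ^ n) \<longlonglongrightarrow> 0"
  shows "(\<lambda>n. cinner (\<pi> (a, x) (\<pi> (inverse (t ^ n), 0) u)) (\<pi> (inverse (t ^ n), 0) v))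
    \<longlonglongrightarrow> cinner (\<pi> (a, 0) u) v"
proof -
  have "cinner (\<pi> (a, x) (\<pi> (inverse (t ^ n), 0) u)) (\<pi> (inverse (t ^ n), 0) v) =
      cinner (\<pi> (a, t ^ n *s x) u) v" for n
  proof -
    have "\<pi> (a, x) (\<pi> (inverse (t ^ n), 0) u) = \<pi> (inverse (t ^ n), 0) (\<pi> (a, t ^ n *s x) u)"
    proof -
      have "inverse (t ^ n) *s (t ^ n *s x) = x" and "a *s 0 = (0 :: 'k ^ 'n)"
        using \<open>t \<noteq> 0\<close> by (simp_all add: vec_eq_iff)
      then show ?thesis
        using \<open>a \<noteq> 0\<close> \<open>t \<noteq> 0\<close> by (simp add: scaling_rep_mult[OF \<pi>] mult.commute)
    qed
    then show ?thesis
      using \<open>t \<noteq> 0\<close> by (simp add: unitary_cinner[OF scaling_rep_unitary[OF \<pi>]])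
  qed
  moreover have "(\<lambda>n. cinner (\<pi> (a, t ^ n *s x) u) v) \<longlonglongrightarrow> cinner (\<pi> (a, 0) u) v"
  proof (intro tendsto_cinner tendsto_const continuous_on_tendsto_compose[OF scaling_rep_continuous[OF \<pi>]])
    have "(\<lambda>n. t ^ n *s x) \<longlonglongrightarrow> (\<chi> i. 0 * x $ i)"
      unfolding vector_scalar_mult_def by (intro tendsto_intros t)
    then have "(\<lambda>n. t ^ n *s x) \<longlonglongrightarrow> 0"
      by (simp add: zero_vec_def)
    then show "(\<lambda>n. (a, t ^ n *s x)) \<longlonglongrightarrow> (a, 0)"
      by (intro tendsto_intros)
  qed (use \<open>a \<noteq> 0\<close> in auto)
  ultimately show ?thesis
    by simp
qed

lemma countable_dense_in_orbit:
  fixes \<rho> :: "'k::second_countable_topology \<Rightarrow> 'h::real_normed_vector"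
  assumes "open S" "S \<noteq> {}" "continuous_on S \<rho>" "0 < e"
  shows "\<exists>d :: nat \<Rightarrow> 'k. range d \<subseteq> S \<and> (\<forall>a\<in>S. \<exists>i. norm (\<rho> a - \<rho> (d i)) < e)"
proof -
  obtain D :: "'k set" where D: "countable D" "\<And>X. open X \<Longrightarrow> X \<noteq> {} \<Longrightarrow> \<exists>d\<in>D. d \<in> X"
    using countable_dense_exists[where ?'a = 'k] by (elim exE conjE) simp
  have "D \<inter> S \<noteq> {}"
    using D(2)[OF assms(1,2)] by blast
  have "\<exists>i. norm (\<rho> a - \<rho> (from_nat_into (D \<inter> S) i)) < e" if "a \<in> S" for a
  proof -
    have "open (S \<inter> \<rho> -` ball (\<rho> a) e)"
      using assms by (intro continuous_open_preimage) auto
    moreover have "a \<in> S \<inter> \<rho> -` ball (\<rho> a) e"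
      using that \<open>0 < e\<close> by simp
    ultimately obtain d where "d \<in> D" "d \<in> S \<inter> \<rho> -` ball (\<rho> a) e"
      using D(2)[of "S \<inter> \<rho> -` ball (\<rho> a) e"] by blast
    moreover have "from_nat_into (D \<inter> S) (to_nat_on (D \<inter> S) d) = d"
      using calculation D(1) by (intro from_nat_into_to_nat_on) auto
    ultimately show ?thesis
      by (intro exI[of _ "to_nat_on (D \<inter> S) d"]) (simp add: dist_norm)
  qed
  then show ?thesis
    using range_from_nat_into_subset[OF \<open>D \<inter> S \<noteq> {}\<close>] by blast
qed

theorem theorem3p1:
  fixes \<mu> :: "('k::{local_field, field_char_0} \<times> ('k ^ 'n)) measure"
    and \<pi> :: "'k \<times> ('k ^ 'n) \<Rightarrow> 'h::complex_hilbert_space \<Rightarrow> 'h"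
  assumes "unitary_system scaling_group scaling_group_topology \<mu> \<pi>"
    and "\<exists>u :: 'h. u \<noteq> 0"
  shows "\<not> (\<exists>a. rate_of_random_mixing scaling_group \<mu> \<pi> a)"
proof
  assume "\<exists>a. rate_of_random_mixing scaling_group \<mu> \<pi> a"
  then obtain a where rate: "rate_of_random_mixing scaling_group \<mu> \<pi> a"
    by (elim exE)
  have pos: "0 < a m" if "1 \<le> m" for m
    using rate that by (simp add: rate_of_random_mixing_def)
  have lim: "a \<longlonglongrightarrow> 0"
    using rate by (simp add: rate_of_random_mixing_def)
  let ?G = "scaling_group :: ('k \<times> ('k ^ 'n)) monoid"
  let ?T = "scaling_group_topology :: ('k \<times> ('k ^ 'n)) topology"
  let ?S = "(- {0 :: 'k}) \<times> (UNIV :: ('k ^ 'n) set)"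
  let ?M = "\<Pi>\<^sub>M i\<in>(UNIV :: nat set). \<mu>"
  interpret unitary_system ?G ?T \<mu> \<pi>
    by fact
  note \<pi> = representation
  interpret M: prob_space ?M
    by (rule prob_space_PiM) (rule prob)
  have sets: "sets \<mu> = sets (borel_of ?T)"
    using regular by (simp add: regular_borel_measure_def)
  have monoid: "monoid ?G" ..
  let ?g = "\<lambda>m \<omega>. random_walk ?G \<omega> m"
  have g_measurable: "?g m \<in> measurable ?M (borel_of ?T)" for m
    by (rule random_walk_measurable[OF sets monoid])
  have g_in: "?g m \<omega> \<in> ?S" if "\<omega> \<in> space ?M" for m \<omega>
    using measurable_space[OF g_measurable that, of m]
    by (simp add: space_borel_of scaling_group_topology_eq)
  have A_nonzero: "fst (?g m \<omega>) \<noteq> 0" if "\<omega> \<in> space ?M" for m \<omega>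
    using g_in[OF that, of m] by (simp add: mem_Times_iff)
  have measurable_on_walk: "(\<lambda>\<omega>. h (?g m \<omega>)) \<in> borel_measurable ?M"
    if "continuous_on ?S h" for h :: "_ \<Rightarrow> real" and m
    using borel_of_measurable_continuous_on[OF that] g_measurable[of m]
    unfolding scaling_group_topology_eq by (rule measurable_compose[rotated])
  have coeff_continuous: "continuous_on ?S (\<lambda>g. cmod (cinner (\<pi> g u) v))" for u v
    using scaling_rep_continuous[OF \<pi>, of u] unfolding continuous_on_def
    by (intro ballI tendsto_norm tendsto_cinner tendsto_const) blast
  have \<rho>_continuous: "continuous_on (- {0}) (\<lambda>b. \<pi> (b, 0) u)" for u
    by (intro continuous_on_compose2[OF scaling_rep_continuous[OF \<pi>]] continuous_intros) auto
  have \<rho>_continuous': "continuous_on ?S (\<lambda>g. \<pi> (fst g, 0) u)" for u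
    by (intro continuous_on_compose2[OF scaling_rep_continuous[OF \<pi>]] continuous_intros) auto
  have "AE \<omega> in ?M. \<exists>C. \<forall>m\<ge>1. cmod (cinner (\<pi> (?g m \<omega>) u) v) \<le> C * a m" for u v
  proof -
    have "AE \<omega> in ?M. limsup (\<lambda>m. ereal (cmod (cinner (\<pi> (?g m \<omega>) u) v) / a m)) < \<infinity>"
      using rate by (simp add: rate_of_random_mixing_def)
    then show ?thesis
      by eventually_elim (rule bounded_if_limsup_finite, auto intro: pos)
  qed
  moreover have "unitary_operator (\<pi> (?g m \<omega>))" if "\<omega> \<in> space ?M" for m \<omega>
    using scaling_rep_unitary[OF \<pi> A_nonzero[OF that], of m "snd (?g m \<omega>)"] by simp
  ultimately have "\<exists>C>0. \<exists>r>0. \<forall>m\<ge>1. \<forall>u v. norm u < r \<longrightarrow> norm v < r \<longrightarrow>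
      (\<integral>\<omega>. min 1 (cmod (cinner (\<pi> (?g m \<omega>) u) v) / (C * a m)) \<partial>?M) \<le> 1 / 4"
    by (intro truncated_coefficients_uniformly_small[where U = "\<lambda>m \<omega>. \<pi> (?g m \<omega>)"] pos
        measurable_on_walk coeff_continuous M.prob_space_axioms) auto
  then obtain C r where "0 < C" "0 < r" and bound: "\<And>m u v. 1 \<le> m \<Longrightarrow> norm u < r \<Longrightarrow> norm v < r \<Longrightarrow>
      (\<integral>\<omega>. min 1 (cmod (cinner (\<pi> (?g m \<omega>) u) v) / (C * a m)) \<partial>?M) \<le> 1 / 4"
    by blast
  let ?\<rho> = "\<lambda>m \<omega>. \<pi> (fst (?g m \<omega>), 0)"
  have \<rho>_coeff_measurable: "(\<lambda>\<omega>. cmod (cinner (?\<rho> m \<omega> u) v)) \<in> borel_measurable ?M" for m u v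
  proof (rule measurable_on_walk)
    show "continuous_on ?S (\<lambda>g. cmod (cinner (\<pi> (fst g, 0) u) v))"
      using \<rho>_continuous'[of u] unfolding continuous_on_def
      by (intro ballI tendsto_norm tendsto_cinner tendsto_const) blast
  qed
  obtain t :: 'k where t: "t \<noteq> 0" "(\<lambda>n. t ^ n) \<longlonglongrightarrow> 0"
    by (rule topologically_nilpotent_unit)
  have bound': "(\<integral>\<omega>. min 1 (cmod (cinner (?\<rho> m \<omega> u) v) / (C * a m)) \<partial>?M) \<le> 1 / 4"
    if m: "1 \<le> m" and uv: "norm u < r" "norm v < r" for m u v
  proof (rule LIMSEQ_le_const2)
    let ?u = "\<lambda>n. \<pi> (inverse (t ^ n), 0) u" and ?v = "\<lambda>n. \<pi> (inverse (t ^ n), 0) v"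
    have "0 < C * a m"
      using \<open>0 < C\<close> pos[OF m] by simp
    show "(\<lambda>n. \<integral>\<omega>. min 1 (cmod (cinner (\<pi> (?g m \<omega>) (?u n)) (?v n)) / (C * a m)) \<partial>?M)
        \<longlonglongrightarrow> (\<integral>\<omega>. min 1 (cmod (cinner (?\<rho> m \<omega> u) v) / (C * a m)) \<partial>?M)"
    proof (rule truncated_integral_tendsto[OF M.prob_space_axioms])
      show "(\<lambda>\<omega>. cmod (cinner (\<pi> (?g m \<omega>) (?u n)) (?v n)) / (C * a m)) \<in> borel_measurable ?M" for n
        by (intro borel_measurable_divide measurable_on_walk coeff_continuous borel_measurable_const)
      show "(\<lambda>\<omega>. cmod (cinner (?\<rho> m \<omega> u) v) / (C * a m)) \<in> borel_measurable ?M"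
        by (intro borel_measurable_divide \<rho>_coeff_measurable borel_measurable_const)
      show "0 \<le> cmod (cinner (\<pi> (?g m \<omega>) (?u n)) (?v n)) / (C * a m)" for n \<omega>
        using \<open>0 < C * a m\<close> by simp
      show "(\<lambda>n. cmod (cinner (\<pi> (?g m \<omega>) (?u n)) (?v n)) / (C * a m))
          \<longlonglongrightarrow> cmod (cinner (?\<rho> m \<omega> u) v) / (C * a m)" if "\<omega> \<in> space ?M" for \<omega>
        using dilation_limit_of_coefficient[OF \<pi> A_nonzero[OF that] t, of m "snd (?g m \<omega>)" u v] \<open>0 < C * a m\<close>
        by (intro tendsto_divide tendsto_norm tendsto_const) auto
    qed
    have "norm (?u n) = norm u" "norm (?v n) = norm v" for n
      using t(1) by (simp_all add: unitary_norm[OF scaling_rep_unitary[OF \<pi>]])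
    then show "\<exists>N. \<forall>n\<ge>N. (\<integral>\<omega>. min 1 (cmod (cinner (\<pi> (?g m \<omega>) (?u n)) (?v n)) / (C * a m)) \<partial>?M) \<le> 1 / 4"
      using uv by (intro exI[of _ 0] allI impI bound m) simp_all
  qed
  \<comment> \<open>A vector \<open>v\<close> of norm \<open>r/2\<close> has \<open>\<parallel>v\<parallel>\<^sup>2/2 = r\<^sup>2/8\<close>, which for this \<open>m\<close> exceeds the scale \<open>C a m\<close>
    of the truncation.\<close>
  have "eventually (\<lambda>m. a m < r\<^sup>2 / (8 * C)) sequentially"
    by (rule order_tendstoD(2)[OF lim]) (use \<open>0 < C\<close> \<open>0 < r\<close> in simp)
  from eventually_happens'[OF sequentially_bot eventually_conj[OF this eventually_ge_at_top[of 1]]]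
  obtain m where m: "a m < r\<^sup>2 / (8 * C)" "1 \<le> m"
    by (elim exE conjE)
  define R where "R = (\<lambda>b. \<pi> (b, 0)) ` (- {0})"
  have R: "commuting_unitaries R"
  proof -
    have comp: "\<pi> (b, 0) \<circ> \<pi> (c, 0) = \<pi> (b * c, 0)" if "b \<noteq> 0" "c \<noteq> 0" for b c
    proof -
      have "b *s 0 = (0 :: 'k ^ 'n)"
        by (simp add: vec_eq_iff)
      then show ?thesis
        using that by (simp add: fun_eq_iff scaling_rep_mult[OF \<pi>])
    qed
    then show ?thesis
      unfolding commuting_unitaries_def R_def
      by (auto simp: comp mult.commute intro: scaling_rep_unitary[OF \<pi>])
  qed
  obtain u :: 'h where "u \<noteq> 0"
    using assms(2) by (elim exE)
  have "1 \<in> - {0 :: 'k}"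
    by simp
  then have "- {0 :: 'k} \<noteq> {}"
    by blast
  then have "\<exists>d :: nat \<Rightarrow> 'k. range d \<subseteq> - {0} \<and>
      (\<forall>b\<in>- {0}. \<exists>i. norm (\<pi> (b, 0) u - \<pi> (d i, 0) u) < norm u / 16)"
    using \<open>u \<noteq> 0\<close> by (intro countable_dense_in_orbit \<rho>_continuous open_Compl closed_singleton) simp_all
  then obtain d :: "nat \<Rightarrow> 'k" where d: "range d \<subseteq> - {0}"
    "\<forall>b\<in>- {0}. \<exists>i. norm (\<pi> (b, 0) u - \<pi> (d i, 0) u) < norm u / 16"
    by (elim exE conjE)
  have "\<exists>w. w \<noteq> 0 \<and>
      1 / 2 \<le> measure ?M {\<omega> \<in> space ?M. (norm w)\<^sup>2 / 2 \<le> cmod (cinner (?\<rho> m \<omega> w) w)}"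
  proof (rule random_almost_eigenvector[OF M.prob_space_axioms R _ _ \<open>u \<noteq> 0\<close>])
    show "?\<rho> m \<omega> \<in> R" if "\<omega> \<in> space ?M" for \<omega>
      using A_nonzero[OF that] by (simp add: R_def)
    show "\<pi> (d i, 0) \<in> R" for i
      using d(1) by (auto simp: R_def)
    show "\<exists>i. norm (?\<rho> m \<omega> u - \<pi> (d i, 0) u) < norm u / 16" if "\<omega> \<in> space ?M" for \<omega>
      using A_nonzero[OF that] d(2) by simp
    show "(\<lambda>\<omega>. norm (?\<rho> m \<omega> w - v)) \<in> borel_measurable ?M" for w v
      by (rule measurable_on_walk) (intro continuous_intros \<rho>_continuous')
  qed (rule \<rho>_coeff_measurable)
  then obtain w where "w \<noteq> 0"
    and w: "1 / 2 \<le> measure ?M {\<omega> \<in> space ?M. (norm w)\<^sup>2 / 2 \<le> cmod (cinner (?\<rho> m \<omega> w) w)}"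
    by (elim exE conjE)
  define s where "s = r / (2 * norm w)"
  define v where "v = scaleC (complex_of_real s) w"
  have "0 < s" and s: "s * norm w = r / 2"
    using \<open>0 < r\<close> \<open>w \<noteq> 0\<close> by (simp_all add: s_def)
  have "norm v < r"
    using \<open>0 < r\<close> \<open>0 < s\<close> s by (simp add: v_def norm_scaleC)
  let ?E = "{\<omega> \<in> space ?M. (norm w)\<^sup>2 / 2 \<le> cmod (cinner (?\<rho> m \<omega> w) w)}"
  have "1 \<le> cmod (cinner (?\<rho> m \<omega> v) v) / (C * a m)" if "\<omega> \<in> ?E" for \<omega>
  proof -
    have \<omega>: "\<omega> \<in> space ?M" "(norm w)\<^sup>2 / 2 \<le> cmod (cinner (?\<rho> m \<omega> w) w)"
      using that by auto
    have "C * a m \<le> r\<^sup>2 / 8"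
      using m(1) \<open>0 < C\<close> by (simp add: field_simps)
    also have "\<dots> = (s * norm w)\<^sup>2 / 2"
      unfolding s by (simp add: power_divide)
    also have "\<dots> = s\<^sup>2 * ((norm w)\<^sup>2 / 2)"
      by (simp add: power_mult_distrib)
    also have "\<dots> \<le> s\<^sup>2 * cmod (cinner (?\<rho> m \<omega> w) w)"
      using \<omega>(2) by (intro mult_left_mono) auto
    also have "\<dots> = cmod (cinner (?\<rho> m \<omega> v) v)"
      using \<open>0 < s\<close>
      by (simp add: v_def unitary_scaleC[OF scaling_rep_unitary[OF \<pi> A_nonzero[OF \<omega>(1)]]]
          cinner_scaleC_left cinner_scaleC_right norm_mult power2_eq_square)
    finally show ?thesis
      using \<open>0 < C\<close> pos[OF m(2)] by simp
  qed
  then have "(\<integral>\<omega>. indicator ?E \<omega> \<partial>?M) \<le> (\<integral>\<omega>. min 1 (cmod (cinner (?\<rho> m \<omega> v) v) / (C * a m)) \<partial>?M)"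
    (is "_ \<le> (\<integral>\<omega>. ?t \<omega> \<partial>?M)")
  proof (intro integral_mono)
    have E: "?E \<in> sets ?M"
      using \<rho>_coeff_measurable[of m w w] by measurable
    show "integrable ?M (indicator ?E :: _ \<Rightarrow> real)"
      by (rule M.integrable_const_bound[of _ 1, OF _ borel_measurable_indicator[OF E]])
        (auto simp: indicator_def)
    show "integrable ?M ?t"
      using \<rho>_coeff_measurable[of m v v] \<open>0 < C\<close> pos[OF m(2)]
      by (intro M.integrable_const_bound[of _ 1]) (auto simp: min_def)
  qed (use \<open>0 < C\<close> pos[OF m(2)] in \<open>auto simp: indicator_def min_def\<close>)
  also have "\<dots> \<le> 1 / 4"
    by (rule bound'[OF m(2) \<open>norm v < r\<close> \<open>norm v < r\<close>])
  finally have "measure ?M ?E \<le> 1 / 4"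
    by (simp add: Int_absorb2 subset_eq)
  with w show False
    by simp
qed

end
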